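(* (BDF Hilbert Syzygy Theorem) Let $k$ be a field, $\Gamma$ an abelian group, and $R$ a PDCF $\Gamma$-graded $k$-algebra which is an integral domain, such that the graded maximal ideal $R_+=\bigoplus_{q>_Q0}R_q$ is generated by a regular sequence $(r_i\mid i\in\mathbb{N})$ of homogeneous elements of $R$. Then for every BDF $\Gamma$-graded $R$-module $M$ there exists a BDF $\Gamma$-finite free resolution of $M$, i.e. an exact sequence of graded $R$-linear maps $\cdots\to F_2\to F_1\to F_0\to M\to 0$ in which every $F_n$ is a free BDF $\Gamma$-graded $R$-module and the sequence $\cdots\to F_2\to F_1\to F_0\to0$ is $\Gamma$-finite.
   Context: Abelian groups and monoids are written additively. A $\Gamma$-graded $k$-algebra is a commutative $k$-algebra $R$ with $k$-subspaces $R_g$ ($g\in\Gamma$) such that $R=\bigoplus_{g\in\Gamma}R_g$ and $R_gR_h\subseteq R_{g+h}$. A $\Gamma$-graded $R$-module is an $R$-module $M$ with $k$-subspaces $M_g$ such that $M=\bigoplus_{g\in\Gamma}M_g$ and $R_gM_h\subseteq M_{g+h}$; elements of some $M_g$ are called homogeneous. An $R$-linear map $\varphi:M\to N$ is graded if $\varphi(M_g)\subseteq N_g$ for all $g$. Write $\mathrm{Supp}_\Gamma(M)=\{g\in\Gamma\mid M_g\neq 0\}$. Since $R$ is a domain, $Q:=\mathrm{Supp}_\Gamma(R)$ is a submonoid of $\Gamma$ (the image monoid). $Q$ is pointed if $p+q=0$ with $p,q\in Q$ implies $p=q=0$; then $g\le_Q h :\iff h-g\in Q$ is a partial order on $\Gamma$.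 A subset $U\subseteq\Gamma$ is downward finite if for every $g\in\Gamma$ the set $\{u\in U\mid u\le_Q g\}$ is finite; it is finitely bounded below if there are finitely many $p_1,\dots,p_n\in\Gamma$ such that every $u\in U$ satisfies $p_i\le_Q u$ for some $i$. $R$ is PDCF if $Q$ is pointed and downward finite, $R$ is connected ($R_0=k$), and $\dim_k R_g<\infty$ for all $g\in\Gamma$. A $\Gamma$-graded $R$-module $M$ is BDF if $\mathrm{Supp}_\Gamma(M)$ is finitely bounded below and downward finite and $\dim_k M_g<\infty$ for all $g\in\Gamma$. A sequence $\cdots\to M_2\to M_1\to M_0\to0$ of BDF $\Gamma$-graded $R$-modules and graded maps is $\Gamma$-finite if (GF1) $\bigcup_{n\ge0}\mathrm{Supp}_\Gamma(M_n)$ is finitely bounded below and downward finite, and (GF2) for each $g\in\Gamma$, $(M_n)_g=0$ for all sufficiently large $n$. A family $(r_i\mid i\in\mathbb{N})$ ($\mathbb N=\{1,2,\dots\}$) in $R$ is a regular sequence if $(r_1,r_2,\dots)\neq R$ and for every $n\ge0$ the element $r_{n+1}$ is not a zero divisor on $R/(r_1,\dots,r_n)$. *)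

theory Defs
  imports "HOL-Algebra.QuotRing" "Jordan_Normal_Form.Missing_VectorSpace"
begin

text \<open>
  The grading group is a type \<open>'g\<close> of class \<^class>\<open>ab_group_add\<close>. A grading of a structure with
  carrier in \<open>'a\<close> is a family \<open>'g \<Rightarrow> 'a set\<close> assigning to each degree its homogeneous component.
  A \<open>k\<close>-algebra is an algebra in the sense of the locale \<^locale>\<open>algebra\<close>: the record of \<open>R\<close> carries
  both its ring operations and, as \<open>smult\<close>, the action of \<open>k\<close>.
\<close>

section \<open>Graded algebras and graded modules\<close>

definition is_direct_sum :: "('v, 'z) ring_scheme \<Rightarrow> ('g \<Rightarrow> 'v set) \<Rightarrow> bool" where
  "is_direct_sum V VG \<longleftrightarrow>
    (\<forall>x\<in>carrier V. \<exists>!f. (\<forall>g. f g \<in> VG g) \<and> finite {g. f g \<noteq> \<zero>\<^bsub>V\<^esub>} \<and>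
       x = (\<Oplus>\<^bsub>V\<^esub>g\<in>{g. f g \<noteq> \<zero>\<^bsub>V\<^esub>}. f g))"

definition graded_space ::
    "('k, 'z) ring_scheme \<Rightarrow> ('k, 'v) module \<Rightarrow> ('g \<Rightarrow> 'v set) \<Rightarrow> bool" where
  "graded_space k V VG \<longleftrightarrow> (\<forall>g. VectorSpace.subspace k (VG g) V) \<and> is_direct_sum V VG"

definition graded_algebra ::
    "('k, 'z) ring_scheme \<Rightarrow> ('k, 'r) module \<Rightarrow> ('g :: ab_group_add \<Rightarrow> 'r set) \<Rightarrow> bool" where
  "graded_algebra k R RG \<longleftrightarrow>
    algebra k R \<and> graded_space k R RG \<and>
    (\<forall>g h. \<forall>x\<in>RG g. \<forall>y\<in>RG h. x \<otimes>\<^bsub>R\<^esub> y \<in> RG (g + h))"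

text \<open>An \<open>R\<close>-module viewed as a \<open>k\<close>-module along \<open>k \<rightarrow> R\<close>, \<open>c \<mapsto> c \<cdot> 1\<close>.\<close>

definition restrict_scalars :: "('k, 'r) module \<Rightarrow> ('r, 'm) module \<Rightarrow> ('k, 'm) module" where
  "restrict_scalars R M =
    \<lparr>carrier = carrier M, monoid.mult = monoid.mult M, one = one M, ring.zero = ring.zero M,
     ring.add = ring.add M, smult = (\<lambda>c x. (c \<odot>\<^bsub>R\<^esub> \<one>\<^bsub>R\<^esub>) \<odot>\<^bsub>M\<^esub> x)\<rparr>"

definition graded_module ::
    "('k, 'z) ring_scheme \<Rightarrow> ('k, 'r) module \<Rightarrow> ('g :: ab_group_add \<Rightarrow> 'r set) \<Rightarrow>
     ('r, 'm) module \<Rightarrow> ('g \<Rightarrow> 'm set) \<Rightarrow> bool" where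
  "graded_module k R RG M MG \<longleftrightarrow>
    module R M \<and> graded_space k (restrict_scalars R M) MG \<and>
    (\<forall>g h. \<forall>a\<in>RG g. \<forall>x\<in>MG h. a \<odot>\<^bsub>M\<^esub> x \<in> MG (g + h))"

definition graded_map ::
    "('r, 'z) ring_scheme \<Rightarrow> ('r, 'm) module \<Rightarrow> ('g \<Rightarrow> 'm set) \<Rightarrow>
     ('r, 'n) module \<Rightarrow> ('g \<Rightarrow> 'n set) \<Rightarrow> ('m \<Rightarrow> 'n) \<Rightarrow> bool" where
  "graded_map R M MG N NG \<phi> \<longleftrightarrow> \<phi> \<in> module_hom R M N \<and> (\<forall>g. \<phi> ` MG g \<subseteq> NG g)"

definition graded_support :: "('v, 'z) ring_scheme \<Rightarrow> ('g \<Rightarrow> 'v set) \<Rightarrow> 'g set" where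
  "graded_support V VG = {g. VG g \<noteq> {\<zero>\<^bsub>V\<^esub>}}"

definition locally_fin_dim ::
    "('k, 'z) ring_scheme \<Rightarrow> ('k, 'v) module \<Rightarrow> ('g \<Rightarrow> 'v set) \<Rightarrow> bool" where
  "locally_fin_dim k V VG \<longleftrightarrow> (\<forall>g. vectorspace.fin_dim k (V\<lparr>carrier := VG g\<rparr>))"

section \<open>Finiteness conditions on subsets of the grading group\<close>

definition pointed :: "'g :: ab_group_add set \<Rightarrow> bool" where
  "pointed Q \<longleftrightarrow> (\<forall>p\<in>Q. \<forall>q\<in>Q. p + q = 0 \<longrightarrow> p = 0 \<and> q = 0)"

definition le_by :: "'g :: ab_group_add set \<Rightarrow> 'g \<Rightarrow> 'g \<Rightarrow> bool" where
  "le_by Q g h \<longleftrightarrow> h - g \<in> Q"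

definition downward_finite :: "'g :: ab_group_add set \<Rightarrow> 'g set \<Rightarrow> bool" where
  "downward_finite Q U \<longleftrightarrow> (\<forall>g. finite {u \<in> U. le_by Q u g})"

definition finitely_bounded_below :: "'g :: ab_group_add set \<Rightarrow> 'g set \<Rightarrow> bool" where
  "finitely_bounded_below Q U \<longleftrightarrow> (\<exists>P. finite P \<and> (\<forall>u\<in>U. \<exists>p\<in>P. le_by Q p u))"

section \<open>PDCF algebras, BDF modules and regular sequences\<close>

definition pdcf ::
    "('k, 'z) ring_scheme \<Rightarrow> ('k, 'r) module \<Rightarrow> ('g :: ab_group_add \<Rightarrow> 'r set) \<Rightarrow> bool" where
  "pdcf k R RG \<longleftrightarrow>
    pointed (graded_support R RG) \<and>
    downward_finite (graded_support R RG) (graded_support R RG) \<and>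
    RG 0 = (\<lambda>c. c \<odot>\<^bsub>R\<^esub> \<one>\<^bsub>R\<^esub>) ` carrier k \<and>
    locally_fin_dim k R RG"

definition bdf_module ::
    "('k, 'z) ring_scheme \<Rightarrow> ('k, 'r) module \<Rightarrow> ('g :: ab_group_add \<Rightarrow> 'r set) \<Rightarrow>
     ('r, 'm) module \<Rightarrow> ('g \<Rightarrow> 'm set) \<Rightarrow> bool" where
  "bdf_module k R RG M MG \<longleftrightarrow>
    graded_module k R RG M MG \<and>
    finitely_bounded_below (graded_support R RG) (graded_support M MG) \<and>
    downward_finite (graded_support R RG) (graded_support M MG) \<and>
    locally_fin_dim k (restrict_scalars R M) MG"

text \<open>
  The direct sum of the components of degree \<open>q > 0\<close>, realised inside \<open>R\<close> as the \<open>k\<close>-span of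
  these components; it is an internal direct sum because the components of \<open>R\<close> are independent.
\<close>

definition positive_part ::
    "('k, 'z) ring_scheme \<Rightarrow> ('k, 'r) module \<Rightarrow> ('g :: ab_group_add \<Rightarrow> 'r set) \<Rightarrow> 'r set" where
  "positive_part k R RG =
    module.span k R (\<Union>q\<in>{q. le_by (graded_support R RG) 0 q \<and> q \<noteq> 0}. RG q)"

text \<open>
  Sequences are indexed from \<open>0\<close>: the value \<open>r n\<close> is the \<open>(n+1)\<close>-st element, and it is tested against
  the ideal generated by the \<open>n\<close> elements before it.
\<close>

definition regular_sequence :: "('r, 'z) ring_scheme \<Rightarrow> (nat \<Rightarrow> 'r) \<Rightarrow> bool" where
  "regular_sequence R r \<longleftrightarrow>
    range r \<subseteq> carrier R \<and>
    genideal R (range r) \<noteq> carrier R \<and>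
    (\<forall>n. let I = genideal R (r ` {..<n}) in
       \<forall>C\<in>carrier (R Quot I).
         (I +>\<^bsub>R\<^esub> r n) \<otimes>\<^bsub>R Quot I\<^esub> C = \<zero>\<^bsub>R Quot I\<^esub> \<longrightarrow> C = \<zero>\<^bsub>R Quot I\<^esub>)"

section \<open>Free resolutions\<close>

text \<open>Free in the graded sense: there is a basis consisting of homogeneous elements.\<close>

definition graded_free ::
    "('r, 'z) ring_scheme \<Rightarrow> ('r, 'm) module \<Rightarrow> ('g \<Rightarrow> 'm set) \<Rightarrow> bool" where
  "graded_free R M MG \<longleftrightarrow>
    (\<exists>E \<subseteq> carrier M. (\<forall>e\<in>E. \<exists>g. e \<in> MG g) \<and>
       \<not> module.lin_dep R M E \<and> module.span R M E = carrier M)"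

text \<open>\<open>d n\<close> is the map from \<open>F (n + 1)\<close> to \<open>F n\<close>, and \<open>FG n\<close> is the grading of \<open>F n\<close>. All \<open>F n\<close>
  have their carrier in one type \<open>'f\<close>. The type \<open>'g \<times> nat \<Rightarrow> 'r\<close> is large enough for this: a graded
  free module whose basis has finitely many (or countably many) elements in each degree is isomorphic
  to a module of finitely supported functions on pairs (degree, number) with values in \<open>R\<close>.\<close>

definition gamma_finite ::
    "('k, 'z) ring_scheme \<Rightarrow> ('k, 'r) module \<Rightarrow> ('g :: ab_group_add \<Rightarrow> 'r set) \<Rightarrow>
     (nat \<Rightarrow> ('r, 'm) module) \<Rightarrow> (nat \<Rightarrow> 'g \<Rightarrow> 'm set) \<Rightarrow> (nat \<Rightarrow> 'm \<Rightarrow> 'm) \<Rightarrow> bool" where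
  "gamma_finite k R RG F FG d \<longleftrightarrow>
    (\<forall>n. bdf_module k R RG (F n) (FG n)) \<and>
    (\<forall>n. graded_map R (F (Suc n)) (FG (Suc n)) (F n) (FG n) (d n)) \<and>
    finitely_bounded_below (graded_support R RG) (\<Union>n. graded_support (F n) (FG n)) \<and>
    downward_finite (graded_support R RG) (\<Union>n. graded_support (F n) (FG n)) \<and>
    (\<forall>g. \<exists>N. \<forall>n\<ge>N. FG n g = {\<zero>\<^bsub>F n\<^esub>})"

definition gamma_finite_free_resolution ::
    "('k, 'z) ring_scheme \<Rightarrow> ('k, 'r) module \<Rightarrow> ('g :: ab_group_add \<Rightarrow> 'r set) \<Rightarrow>
     ('r, 'm) module \<Rightarrow> ('g \<Rightarrow> 'm set) \<Rightarrow>
     (nat \<Rightarrow> ('r, 'f) module) \<Rightarrow> (nat \<Rightarrow> 'g \<Rightarrow> 'f set) \<Rightarrow> (nat \<Rightarrow> 'f \<Rightarrow> 'f) \<Rightarrow> ('f \<Rightarrow> 'm) \<Rightarrow> bool"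
  where
  "gamma_finite_free_resolution k R RG M MG F FG d \<epsilon> \<longleftrightarrow>
    gamma_finite k R RG F FG d \<and>
    (\<forall>n. graded_free R (F n) (FG n)) \<and>
    graded_map R (F 0) (FG 0) M MG \<epsilon> \<and>
    \<epsilon> ` carrier (F 0) = carrier M \<and>
    d 0 ` carrier (F (Suc 0)) = a_kernel (F 0) M \<epsilon> \<and>
    (\<forall>n. d (Suc n) ` carrier (F (Suc (Suc n))) = a_kernel (F (Suc n)) (F n) (d n))"

end

theory Submission
  imports Defs
begin

text \<open>
  Let \<open>L\<close> be a graded submodule of a graded module, and let \<open>F\<close> be the graded free module on
  \<open>k\<close>-bases of all components \<open>L\<^sub>h\<close>. The kernel of \<open>F \<rightarrow> L\<close> can only live in degrees lying strictly
  above a degree of \<open>L\<close>: an element of degree \<open>g\<close> supported on the basis of \<open>L\<^sub>g\<close> alone has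
  coefficients in \<open>R\<^sub>0 = k\<close>, so it vanishes if it is mapped to \<open>0\<close>. Iterating, every degree of the
  \<open>n\<close>-th syzygy is the top of a strictly increasing chain of length \<open>n\<close> that starts in the support of
  \<open>M\<close>. Below a given degree such chains have bounded length, by downward finiteness.
\<close>

text \<open>The chains themselves never occur. They are replaced by a number:
  \<open>height g\<close> counts the elements of a fixed set \<open>U\<close> of degrees that lie
  below \<open>g\<close>. Antisymmetry of the order, i.e. pointedness of the support of
  \<open>R\<close>, makes \<open>height\<close> strictly increasing on \<open>U\<close>, so passing
  to a syzygy raises the least possible height by one. \<open>U\<close> is the set of all degrees
  above one of the finitely many lower bounds of the support of \<open>M\<close>. It is a finite
  union of translates of the support of \<open>R\<close>, hence still downward finite, and it
  contains the degrees of every stage. So a single \<open>U\<close> yields GF1, and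
  \<open>height\<close> yields GF2. The other obstacle is typing. A syzygy treated as a module of
  its own, or a free module indexed by the elements of the module it covers, would change type at
  each stage. Therefore syzygies remain subsets of the preceding free module, and a generator is
  named by its degree and a number, so that all stages share one type.\<close>

section \<open>Finite sums in submodules and under linear maps\<close>

lemma (in abelian_monoid) finsum_support:
  assumes "finite A" and "\<And>i. i \<notin> A \<Longrightarrow> f i = \<zero>" and "\<And>i. i \<in> A \<Longrightarrow> f i \<in> carrier G"
  shows "finsum G f {i. f i \<noteq> \<zero>} = finsum G f A"
  by (rule add.finprod_mono_neutral_cong_left) (use assms in auto)

lemma (in module) finsum_mem_submodule:
  assumes H: "submodule R H M" and "finite A" and "\<And>i. i \<in> A \<Longrightarrow> f i \<in> H"
  shows "(\<Oplus>\<^bsub>M\<^esub>i\<in>A. f i) \<in> H"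
  using assms(2,3)
proof (induction A rule: finite_induct)
  case empty
  then show ?case using H by (simp add: submodule_def)
next
  case (insert x F)
  moreover have "H \<subseteq> carrier M" using H by (simp add: submodule_def)
  ultimately show ?case
    using H by (subst M.finsum_insert) (auto simp: submodule_def)
qed

lemma (in module) submodule_uminus:
  assumes "submodule R H M" and "x \<in> H"
  shows "\<ominus>\<^bsub>M\<^esub> x \<in> H"
proof -
  have "x \<in> carrier M" and "(\<ominus> \<one>) \<odot>\<^bsub>M\<^esub> x \<in> H"
    using assms by (auto simp: submodule_def)
  then show ?thesis
    by (simp add: smult_l_minus)
qed

lemma (in mod_hom) hom_finsum:
  assumes "finite A" and "\<And>i. i \<in> A \<Longrightarrow> g i \<in> carrier M"
  shows "f (\<Oplus>\<^bsub>M\<^esub>i\<in>A. g i) = (\<Oplus>\<^bsub>N\<^esub>i\<in>A. f (g i))"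
  using assms
proof (induction A rule: finite_induct)
  case (insert x F)
  then show ?case
    by (simp add: M.M.finsum_insert N.M.finsum_insert Pi_def M.M.finsum_closed f_im f_add)
qed simp

section \<open>Direct sum decompositions\<close>

lemma is_direct_sum_decompose:
  assumes "is_direct_sum V VG" and "x \<in> carrier V"
  obtains f where "\<And>g. f g \<in> VG g" and "finite {g. f g \<noteq> \<zero>\<^bsub>V\<^esub>}"
    and "x = (\<Oplus>\<^bsub>V\<^esub>g\<in>{g. f g \<noteq> \<zero>\<^bsub>V\<^esub>}. f g)"
  using assms unfolding is_direct_sum_def by (meson ex1_implies_ex)

text \<open>Extended by zero outside \<open>A\<close>, the family \<open>f\<close> decomposes zero;
  so does the zero family, and decompositions are unique.\<close>

lemma (in abelian_group) is_direct_sum_independent: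
  assumes ds: "is_direct_sum G VG" and sub: "\<And>g. VG g \<subseteq> carrier G" and zero: "\<And>g. \<zero> \<in> VG g"
    and fin: "finite A" and mem: "\<And>g. g \<in> A \<Longrightarrow> f g \<in> VG g" and sum0: "(\<Oplus>g\<in>A. f g) = \<zero>"
    and "g \<in> A"
  shows "f g = \<zero>"
proof -
  define f' where "f' = (\<lambda>g. if g \<in> A then f g else \<zero>)"
  have "(\<Oplus>g\<in>{g. f' g \<noteq> \<zero>}. f' g) = (\<Oplus>g\<in>A. f' g)"
    by (rule finsum_support) (use sub mem fin in \<open>auto simp: f'_def\<close>)
  also have "\<dots> = (\<Oplus>g\<in>A. f g)"
    by (rule finsum_cong') (use sub mem in \<open>auto simp: f'_def\<close>)
  finally have f': "\<zero> = (\<Oplus>g\<in>{g. f' g \<noteq> \<zero>}. f' g)"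
    using sum0 by simp
  have "Uniq (\<lambda>f. (\<forall>g. f g \<in> VG g) \<and> finite {g. f g \<noteq> \<zero>} \<and> \<zero> = (\<Oplus>g\<in>{g. f g \<noteq> \<zero>}. f g))"
    using ds by (simp add: is_direct_sum_def ex1_iff_ex_Uniq)
  then have "f' = (\<lambda>_. \<zero>)"
  proof (rule Uniq_D)
    show "(\<forall>g. f' g \<in> VG g) \<and> finite {g. f' g \<noteq> \<zero>} \<and> \<zero> = (\<Oplus>g\<in>{g. f' g \<noteq> \<zero>}. f' g)"
    proof (intro conjI allI)
      show "finite {g. f' g \<noteq> \<zero>}"
        by (rule finite_subset[OF _ fin]) (auto simp: f'_def)
    qed (use mem zero f' in \<open>simp_all add: f'_def\<close>)
  qed (use zero in simp)
  then have "f' g = \<zero>"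
    by simp
  then show ?thesis
    using \<open>g \<in> A\<close> by (simp add: f'_def)
qed

text \<open>\<open>is_direct_sum\<close> insists on sums over the exact support. This criterion
  allows any finite index set, and closure under differences turns independence into
  uniqueness.\<close>

lemma (in abelian_group) is_direct_sumI:
  assumes sub: "\<And>g. VG g \<subseteq> carrier G" and zero: "\<And>g. \<zero> \<in> VG g"
    and diff: "\<And>g x y. x \<in> VG g \<Longrightarrow> y \<in> VG g \<Longrightarrow> x \<ominus> y \<in> VG g"
    and ex: "\<And>x. x \<in> carrier G \<Longrightarrow> \<exists>A f. finite A \<and> (\<forall>g. f g \<in> VG g) \<and> x = (\<Oplus>g\<in>A. f g)"
    and ind: "\<And>A f g. finite A \<Longrightarrow> (\<And>g. f g \<in> VG g) \<Longrightarrow> (\<Oplus>g\<in>A. f g) = \<zero> \<Longrightarrow> g \<in> A \<Longrightarrow> f g = \<zero>"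
  shows "is_direct_sum G VG"
  unfolding is_direct_sum_def
proof (intro ballI ex_ex1I)
  fix x assume "x \<in> carrier G"
  then obtain A f where A: "finite A" and f: "\<And>g. f g \<in> VG g" and x: "x = (\<Oplus>g\<in>A. f g)"
    using ex by blast
  define f' where "f' = (\<lambda>g. if g \<in> A then f g else \<zero>)"
  have "(\<Oplus>g\<in>{g. f' g \<noteq> \<zero>}. f' g) = (\<Oplus>g\<in>A. f' g)"
    by (rule finsum_support) (use sub f A in \<open>auto simp: f'_def\<close>)
  also have "\<dots> = x"
    unfolding x by (rule finsum_cong') (use sub f in \<open>auto simp: f'_def\<close>)
  finally show "\<exists>f. (\<forall>g. f g \<in> VG g) \<and> finite {g. f g \<noteq> \<zero>} \<and> x = (\<Oplus>g\<in>{g. f g \<noteq> \<zero>}. f g)"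
    using A f zero by (intro exI[of _ f'] conjI allI) (simp_all add: f'_def)
next
  fix x f f'
  assume "x \<in> carrier G" and f: "(\<forall>g. f g \<in> VG g) \<and> finite {g. f g \<noteq> \<zero>} \<and> x = (\<Oplus>g\<in>{g. f g \<noteq> \<zero>}. f g)"
    and f': "(\<forall>g. f' g \<in> VG g) \<and> finite {g. f' g \<noteq> \<zero>} \<and> x = (\<Oplus>g\<in>{g. f' g \<noteq> \<zero>}. f' g)"
  define A where "A = {g. f g \<noteq> \<zero>} \<union> {g. f' g \<noteq> \<zero>}"
  have A: "finite A" using f f' by (simp add: A_def)
  have c: "f g \<in> carrier G" "f' g \<in> carrier G" for g
    using f f' sub by blast+
  have "x = (\<Oplus>g\<in>A. f g)"
    using f finsum_support[of A f, OF A] c by (simp add: A_def)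
  moreover have "x = (\<Oplus>g\<in>A. f' g)"
    using f' finsum_support[of A f', OF A] c by (simp add: A_def)
  moreover have "(\<Oplus>g\<in>A. f g \<ominus> f' g) \<oplus> (\<Oplus>g\<in>A. f' g) = (\<Oplus>g\<in>A. f g)"
  proof -
    have "(\<Oplus>g\<in>A. f g \<ominus> f' g) \<oplus> (\<Oplus>g\<in>A. f' g) = (\<Oplus>g\<in>A. (f g \<ominus> f' g) \<oplus> f' g)"
      by (rule finsum_addf[symmetric]) (use c in auto)
    also have "\<dots> = (\<Oplus>g\<in>A. f g)"
      by (rule finsum_cong') (use c in \<open>auto simp: minus_eq a_assoc l_neg\<close>)
    finally show ?thesis .
  qed
  ultimately have "(\<Oplus>g\<in>A. f g \<ominus> f' g) \<oplus> x = x"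
    by simp
  then have "(\<Oplus>g\<in>A. f g \<ominus> f' g) = \<zero>"
    using c \<open>x \<in> carrier G\<close> add.r_cancel_one by (simp add: Pi_def)
  then have eq0: "f g \<ominus> f' g = \<zero>" if "g \<in> A" for g
    using ind[of A "\<lambda>g. f g \<ominus> f' g"] A diff f f' that by blast
  show "f = f'"
  proof
    fix g show "f g = f' g"
      using minus_other_side[OF c[of g]] eq0[of g] by (cases "g \<in> A") (auto simp: A_def)
  qed
qed

section \<open>Restriction of scalars and vector spaces\<close>

lemma restrict_scalars_simps [simp]:
  "carrier (restrict_scalars R M) = carrier M"
  "add (restrict_scalars R M) = add M"
  "zero (restrict_scalars R M) = zero M"
  "c \<odot>\<^bsub>restrict_scalars R M\<^esub> x = (c \<odot>\<^bsub>R\<^esub> \<one>\<^bsub>R\<^esub>) \<odot>\<^bsub>M\<^esub> x"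
  by (simp_all add: restrict_scalars_def)

lemma finsum_cong_record:
  assumes "carrier V = carrier W" "add V = add W" "zero V = zero W"
  shows "finsum V f A = finsum W f A"
  using assms by (simp add: finsum_def finprod_def)

lemma finsum_restrict_scalars [simp]: "finsum (restrict_scalars R M) f A = finsum M f A"
  by (rule finsum_cong_record) simp_all

lemma is_direct_sum_restrict_scalars [simp]:
  "is_direct_sum (restrict_scalars R M) MG = is_direct_sum M MG"
  by (simp add: is_direct_sum_def)

lemma a_inv_restrict_scalars [simp]: "a_inv (restrict_scalars R M) x = a_inv M x"
  by (simp add: a_inv_def m_inv_def)

text \<open>In this lemma \<open>R\<close> is the base ring and \<open>M\<close> the algebra. The
  axioms transfer because c |-> c 1 is a ring homomorphism from \<open>R\<close> to
  \<open>M\<close>.\<close>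

lemma module_restrict_scalars:
  assumes "algebra R M" and "module M N"
  shows "module R (restrict_scalars M N)"
proof -
  interpret algebra R M by fact
  interpret N: module M N by fact
  have 1: "c \<odot>\<^bsub>M\<^esub> \<one>\<^bsub>M\<^esub> \<in> carrier M" if "c \<in> carrier R" for c
    using that by simp
  show ?thesis
  proof (rule moduleI)
    show "cring R" by (rule R_cring)
    show "abelian_group (restrict_scalars M N)"
    proof (rule abelian_groupI)
      fix x assume "x \<in> carrier (restrict_scalars M N)"
      then show "\<exists>y\<in>carrier (restrict_scalars M N).
          y \<oplus>\<^bsub>restrict_scalars M N\<^esub> x = \<zero>\<^bsub>restrict_scalars M N\<^esub>"
        using N.l_neg by (intro bexI[of _ "\<ominus>\<^bsub>N\<^esub> x"]) simp_all
    qed (simp_all add: N.a_ac)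
  next
    fix a b x assume *: "a \<in> carrier R" "b \<in> carrier R" "x \<in> carrier (restrict_scalars M N)"
    have "(a \<otimes>\<^bsub>R\<^esub> b) \<odot>\<^bsub>M\<^esub> \<one>\<^bsub>M\<^esub> = (a \<odot>\<^bsub>M\<^esub> \<one>\<^bsub>M\<^esub>) \<otimes>\<^bsub>M\<^esub> (b \<odot>\<^bsub>M\<^esub> \<one>\<^bsub>M\<^esub>)"
      using * by (simp add: smult_assoc1 smult_assoc2)
    then show "(a \<otimes>\<^bsub>R\<^esub> b) \<odot>\<^bsub>restrict_scalars M N\<^esub> x =
        a \<odot>\<^bsub>restrict_scalars M N\<^esub> (b \<odot>\<^bsub>restrict_scalars M N\<^esub> x)"
      using * by (simp add: N.smult_assoc1)
  qed (use 1 in \<open>simp_all add: N.smult_l_distr N.smult_r_distr smult_l_distr\<close>)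
qed

text \<open>An independent subset of \<open>W\<close> is independent in \<open>V\<close>, so its
  size is bounded by \<open>dim\<close>. Hence a maximal one exists, and it is a basis of
  \<open>W\<close>. No finite dimension of \<open>W\<close> is presupposed.\<close>

lemma (in vectorspace) finite_basis_of_subspace:
  assumes fd: "fin_dim" and W: "submodule K W V"
  obtains A where "finite A" and "A \<subseteq> W" and "lin_indpt A" and "span A = W"
proof -
  interpret W: vectorspace K "vs W"
    by (rule subspace_is_vs) (use W in \<open>simp add: subspace_def vectorspace_axioms\<close>)
  have WV: "W \<subseteq> carrier V"
    using W by (simp add: submodule_def)
  have "finite A \<and> card A \<le> dim" if "A \<subseteq> W \<and> W.lin_indpt A" for A
    using that li_le_dim[OF fd, of A] span_li_not_depend(2)[of A W] W WV by auto
  moreover have "{} \<subseteq> W \<and> W.lin_indpt {}"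
    by (auto simp: W.lin_dep_def)
  ultimately obtain A where "finite A" and "maximal A (\<lambda>A. A \<subseteq> W \<and> W.lin_indpt A)"
    using maximal_exists[of "\<lambda>A. A \<subseteq> W \<and> W.lin_indpt A" dim "{}"] by blast
  then have "finite A" and "W.basis A"
    using W.max_li_is_basis[of A] by simp_all
  then show thesis
    using that[of A] span_li_not_depend[of A W] W by (simp add: W.basis_def)
qed

section \<open>Free modules of finitely supported functions\<close>

text \<open>Functions are total on the index type and vanish off \<open>I\<close>. Free modules on
  different index sets thus share a type, as the terms of a resolution must.\<close>

definition free_module :: "('r, 'z) ring_scheme \<Rightarrow> 'i set \<Rightarrow> ('r, 'i \<Rightarrow> 'r) module" where
  "free_module R I =
    \<lparr>carrier = {f. (\<forall>i. f i \<in> carrier R) \<and> (\<forall>i. i \<notin> I \<longrightarrow> f i = \<zero>\<^bsub>R\<^esub>) \<and> finite {i. f i \<noteq> \<zero>\<^bsub>R\<^esub>}},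
     monoid.mult = undefined, one = undefined, ring.zero = (\<lambda>_. \<zero>\<^bsub>R\<^esub>),
     ring.add = (\<lambda>f g i. f i \<oplus>\<^bsub>R\<^esub> g i), smult = (\<lambda>a f i. a \<otimes>\<^bsub>R\<^esub> f i)\<rparr>"

definition single :: "('r, 'z) ring_scheme \<Rightarrow> 'i \<Rightarrow> 'r \<Rightarrow> 'i \<Rightarrow> 'r" where
  "single R i a = (\<lambda>j. if j = i then a else \<zero>\<^bsub>R\<^esub>)"

text \<open>The universal property of the free module: the linear map that sends the basis vector at
  \<open>i\<close> to \<open>\<beta> i\<close>.\<close>

definition free_ext ::
    "('r, 'z) ring_scheme \<Rightarrow> ('r, 'm, 'y) module_scheme \<Rightarrow> ('i \<Rightarrow> 'm) \<Rightarrow> ('i \<Rightarrow> 'r) \<Rightarrow> 'm" where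
  "free_ext R M \<beta> f = (\<Oplus>\<^bsub>M\<^esub>i\<in>{i. f i \<noteq> \<zero>\<^bsub>R\<^esub>}. f i \<odot>\<^bsub>M\<^esub> \<beta> i)"

lemma free_module_simps [simp]:
  "\<zero>\<^bsub>free_module R I\<^esub> = (\<lambda>_. \<zero>\<^bsub>R\<^esub>)"
  "f \<oplus>\<^bsub>free_module R I\<^esub> g = (\<lambda>i. f i \<oplus>\<^bsub>R\<^esub> g i)"
  "a \<odot>\<^bsub>free_module R I\<^esub> f = (\<lambda>i. a \<otimes>\<^bsub>R\<^esub> f i)"
  by (simp_all add: free_module_def)

context cring
begin

lemma mem_free_module:
  "f \<in> carrier (free_module R I) \<longleftrightarrow>
    (\<forall>i. f i \<in> carrier R) \<and> (\<forall>i. i \<notin> I \<longrightarrow> f i = \<zero>) \<and> finite {i. f i \<noteq> \<zero>}"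
  by (simp add: free_module_def)

lemma single_same [simp]: "single R i a i = a"
  by (simp add: single_def)

lemma single_mem_free_module: "i \<in> I \<Longrightarrow> a \<in> carrier R \<Longrightarrow> single R i a \<in> carrier (free_module R I)"
  by (auto simp: mem_free_module single_def)

lemma single_zero [simp]: "single R i \<zero> = (\<lambda>_. \<zero>)"
  by (simp add: single_def fun_eq_iff)

lemma module_free_module: "module R (free_module R I)"
proof (rule moduleI)
  show "cring R" ..
  have fin: "finite {i. f i \<oplus> g i \<noteq> \<zero>}"
    if "finite {i. f i \<noteq> \<zero>}" "finite {i. g i \<noteq> \<zero>}" for f g :: "'i \<Rightarrow> 'a"
    by (rule finite_subset[OF _ finite_UnI[OF that]]) auto
  show "abelian_group (free_module R I)"
  proof (rule abelian_groupI)
    fix f assume f: "f \<in> carrier (free_module R I)"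
    then have "(\<lambda>i. \<ominus> f i) \<in> carrier (free_module R I)"
      by (auto simp: mem_free_module intro: rev_finite_subset)
    moreover have "(\<lambda>i. \<ominus> f i) \<oplus>\<^bsub>free_module R I\<^esub> f = \<zero>\<^bsub>free_module R I\<^esub>"
      using f by (auto simp: mem_free_module l_neg)
    ultimately show "\<exists>g\<in>carrier (free_module R I). g \<oplus>\<^bsub>free_module R I\<^esub> f = \<zero>\<^bsub>free_module R I\<^esub>"
      by blast
  qed (auto simp: mem_free_module fin a_ac)
  fix a f assume "a \<in> carrier R" "f \<in> carrier (free_module R I)"
  moreover from this have "{i. a \<otimes> f i \<noteq> \<zero>} \<subseteq> {i. f i \<noteq> \<zero>}"
    by auto
  ultimately show "a \<odot>\<^bsub>free_module R I\<^esub> f \<in> carrier (free_module R I)"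
    by (auto simp: mem_free_module intro: finite_subset)
qed (auto simp: mem_free_module l_distr r_distr m_assoc)

lemma finsum_free_module:
  assumes "finite A" and "\<And>a. a \<in> A \<Longrightarrow> f a \<in> carrier (free_module R I)"
  shows "(\<Oplus>\<^bsub>free_module R I\<^esub>a\<in>A. f a) i = (\<Oplus>a\<in>A. f a i)"
  using assms
proof (induction A rule: finite_induct)
  case empty
  interpret F: module R "free_module R I" by (rule module_free_module)
  show ?case
    by (simp add: F.M.finsum_empty)
next
  case (insert a A)
  interpret F: module R "free_module R I" by (rule module_free_module)
  show ?case
    using insert by (subst F.M.finsum_insert) (auto simp: mem_free_module)
qed

text \<open>Induction on the support, splitting off one entry at a time. The last premise concerns
  only the entries of the given \<open>f\<close>, so what is known about them, such as their
  degrees, can be used there.\<close>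

lemma free_module_induct:
  assumes "f \<in> carrier (free_module R I)" and zero: "H (\<lambda>_. \<zero>)"
    and add: "\<And>f g. f \<in> carrier (free_module R I) \<Longrightarrow> g \<in> carrier (free_module R I) \<Longrightarrow>
      H f \<Longrightarrow> H g \<Longrightarrow> H (\<lambda>i. f i \<oplus> g i)"
    and "\<And>i. i \<in> I \<Longrightarrow> H (single R i (f i))"
  shows "H f"
proof -
  have "finite {i. f i \<noteq> \<zero>}"
    using assms(1) by (simp add: mem_free_module)
  then show ?thesis
    using assms(1,4)
  proof (induction "{i. f i \<noteq> \<zero>}" arbitrary: f rule: finite_psubset_induct)
    case psubset
    show ?case
    proof (cases "\<exists>i. f i \<noteq> \<zero>")
      case True
      then obtain i where i: "f i \<noteq> \<zero>" by blast
      define f' where "f' = f(i := \<zero>)"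
      have iI: "i \<in> I"
        using i psubset.prems(1) by (auto simp: mem_free_module)
      have f': "f' \<in> carrier (free_module R I)"
        using psubset.prems(1) by (auto simp: mem_free_module f'_def intro: rev_finite_subset)
      have "{i. f' i \<noteq> \<zero>} \<subset> {i. f i \<noteq> \<zero>}"
        using i by (auto simp: f'_def)
      moreover have "H (single R j (f' j))" if "j \<in> I" for j
        using psubset.prems(2)[OF that] zero by (simp add: f'_def)
      ultimately have "H f'"
        using psubset.hyps(2)[of f'] f' by blast
      moreover have "single R i (f i) \<in> carrier (free_module R I)"
        using psubset.prems(1) iI by (intro single_mem_free_module) (auto simp: mem_free_module)
      ultimately have "H (\<lambda>j. single R i (f i) j \<oplus> f' j)"
        using add psubset.prems(2)[OF iI] f' by blast
      moreover have "(\<lambda>j. single R i (f i) j \<oplus> f' j) = f"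
        using psubset.prems(1) by (auto simp: single_def f'_def mem_free_module)
      ultimately show ?thesis by simp
    next
      case False
      then have "f = (\<lambda>_. \<zero>)" by auto
      then show ?thesis using zero by simp
    qed
  qed
qed

end

context module
begin

text \<open>The support varies with \<open>f\<close>. A common finite set \<open>A\<close> is what
  makes additivity provable, and what lets a kernel element be summed over all generators of one
  degree.\<close>

lemma free_ext_eq_finsum:
  assumes "f \<in> carrier (free_module R I)" and "\<beta> \<in> I \<rightarrow> carrier M"
    and "finite A" and "{i. f i \<noteq> \<zero>} \<subseteq> A" and "A \<subseteq> I"
  shows "free_ext R M \<beta> f = (\<Oplus>\<^bsub>M\<^esub>i\<in>A. f i \<odot>\<^bsub>M\<^esub> \<beta> i)"
  unfolding free_ext_def
  by (rule M.add.finprod_mono_neutral_cong_left) (use assms in \<open>auto simp: R.mem_free_module Pi_iff subset_iff\<close>)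

lemma mod_hom_free_ext:
  assumes \<beta>: "\<beta> \<in> I \<rightarrow> carrier M"
  shows "mod_hom R (free_module R I) M (free_ext R M \<beta>)"
proof -
  interpret F: module R "free_module R I" by (rule R.module_free_module)
  have closed: "free_ext R M \<beta> f \<in> carrier M" if "f \<in> carrier (free_module R I)" for f
    unfolding free_ext_def using that \<beta> by (intro M.finsum_closed) (auto simp: R.mem_free_module)
  have add: "free_ext R M \<beta> (f \<oplus>\<^bsub>free_module R I\<^esub> g) = free_ext R M \<beta> f \<oplus>\<^bsub>M\<^esub> free_ext R M \<beta> g"
    if f: "f \<in> carrier (free_module R I)" and g: "g \<in> carrier (free_module R I)" for f g
  proof -
    define A where "A = {i. f i \<noteq> \<zero>} \<union> {i. g i \<noteq> \<zero>}"
    have A: "finite A" "A \<subseteq> I"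
      using f g by (auto simp: A_def R.mem_free_module)
    have fc: "f i \<in> carrier R" "g i \<in> carrier R" for i
      using f g by (auto simp: R.mem_free_module)
    have fg: "(\<lambda>i. f i \<oplus> g i) \<in> carrier (free_module R I)"
      using F.M.a_closed[OF f g] by simp
    have "free_ext R M \<beta> (\<lambda>i. f i \<oplus> g i) = (\<Oplus>\<^bsub>M\<^esub>i\<in>A. (f i \<oplus> g i) \<odot>\<^bsub>M\<^esub> \<beta> i)"
      by (rule free_ext_eq_finsum[OF fg \<beta>]) (use A in \<open>auto simp: A_def\<close>)
    also have "\<dots> = (\<Oplus>\<^bsub>M\<^esub>i\<in>A. f i \<odot>\<^bsub>M\<^esub> \<beta> i \<oplus>\<^bsub>M\<^esub> g i \<odot>\<^bsub>M\<^esub> \<beta> i)"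
      by (rule M.finsum_cong') (use A fc \<beta> in \<open>auto simp: smult_l_distr Pi_iff subset_iff\<close>)
    also have "\<dots> = (\<Oplus>\<^bsub>M\<^esub>i\<in>A. f i \<odot>\<^bsub>M\<^esub> \<beta> i) \<oplus>\<^bsub>M\<^esub> (\<Oplus>\<^bsub>M\<^esub>i\<in>A. g i \<odot>\<^bsub>M\<^esub> \<beta> i)"
      by (rule M.finsum_addf) (use A fc \<beta> in \<open>auto simp: Pi_iff subset_iff\<close>)
    also have "(\<Oplus>\<^bsub>M\<^esub>i\<in>A. f i \<odot>\<^bsub>M\<^esub> \<beta> i) = free_ext R M \<beta> f"
      by (rule free_ext_eq_finsum[OF f \<beta>, symmetric]) (use A in \<open>auto simp: A_def\<close>)
    also have "(\<Oplus>\<^bsub>M\<^esub>i\<in>A. g i \<odot>\<^bsub>M\<^esub> \<beta> i) = free_ext R M \<beta> g"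
      by (rule free_ext_eq_finsum[OF g \<beta>, symmetric]) (use A in \<open>auto simp: A_def\<close>)
    finally show ?thesis by simp
  qed
  have smult: "free_ext R M \<beta> (a \<odot>\<^bsub>free_module R I\<^esub> f) = a \<odot>\<^bsub>M\<^esub> free_ext R M \<beta> f"
    if a: "a \<in> carrier R" and f: "f \<in> carrier (free_module R I)" for a f
  proof -
    define A where "A = {i. f i \<noteq> \<zero>}"
    have A: "finite A" "A \<subseteq> I"
      using f by (auto simp: A_def R.mem_free_module)
    have fc: "f i \<in> carrier R" for i
      using f by (auto simp: R.mem_free_module)
    have af: "(\<lambda>i. a \<otimes> f i) \<in> carrier (free_module R I)"
      using F.smult_closed[OF a f] by simp
    have "free_ext R M \<beta> (\<lambda>i. a \<otimes> f i) = (\<Oplus>\<^bsub>M\<^esub>i\<in>A. (a \<otimes> f i) \<odot>\<^bsub>M\<^esub> \<beta> i)"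
      by (rule free_ext_eq_finsum[OF af \<beta>]) (use A a in \<open>auto simp: A_def\<close>)
    also have "\<dots> = (\<Oplus>\<^bsub>M\<^esub>i\<in>A. a \<odot>\<^bsub>M\<^esub> (f i \<odot>\<^bsub>M\<^esub> \<beta> i))"
      by (rule M.finsum_cong') (use A a fc \<beta> in \<open>auto simp: smult_assoc1 Pi_iff subset_iff\<close>)
    also have "\<dots> = a \<odot>\<^bsub>M\<^esub> (\<Oplus>\<^bsub>M\<^esub>i\<in>A. f i \<odot>\<^bsub>M\<^esub> \<beta> i)"
      by (rule finsum_smult_ldistr[symmetric]) (use A a fc \<beta> in \<open>auto simp: Pi_iff subset_iff\<close>)
    also have "(\<Oplus>\<^bsub>M\<^esub>i\<in>A. f i \<odot>\<^bsub>M\<^esub> \<beta> i) = free_ext R M \<beta> f"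
      by (simp add: free_ext_def A_def)
    finally show ?thesis by simp
  qed
  show ?thesis
    unfolding mod_hom_def mod_hom_axioms_def module_hom_def
    using closed add smult F.module_axioms module_axioms by blast
qed

lemma free_ext_single:
  assumes "\<beta> \<in> I \<rightarrow> carrier M" and "i \<in> I" and "a \<in> carrier R"
  shows "free_ext R M \<beta> (single R i a) = a \<odot>\<^bsub>M\<^esub> \<beta> i"
proof -
  have "free_ext R M \<beta> (single R i a) = (\<Oplus>\<^bsub>M\<^esub>j\<in>{i}. single R i a j \<odot>\<^bsub>M\<^esub> \<beta> j)"
    by (rule free_ext_eq_finsum[OF R.single_mem_free_module])
      (use assms in \<open>auto simp: single_def\<close>)
  then show ?thesis
    using assms by (auto simp: Pi_iff)
qed

end

lemma (in cring) free_module_basis: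
  defines "E \<equiv> \<lambda>I. (\<lambda>i. single R i \<one>) ` I"
  shows "\<not> module.lin_dep R (free_module R I) (E I)"
    and "module.span R (free_module R I) (E I) = carrier (free_module R I)"
proof -
  interpret F: module R "free_module R I" by (rule module_free_module)
  have E: "E I \<subseteq> carrier (free_module R I)"
    by (auto simp: E_def intro: single_mem_free_module)
  show "F.lin_indpt (E I)"
  proof
    assume "F.lin_dep (E I)"
    then obtain A a v where A: "finite A" "A \<subseteq> E I" and a: "a \<in> A \<rightarrow> carrier R"
      and lc: "F.lincomb a A = \<zero>\<^bsub>free_module R I\<^esub>" and v: "v \<in> A" "a v \<noteq> \<zero>"
      unfolding F.lin_dep_def by blast
    \<comment> \<open>Evaluating the relation at the coordinate \<open>i\<close> isolates the
      coefficient of \<open>v\<close>: every other basis vector vanishes there.\<close>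
    obtain i where i: "v = single R i \<one>"
      using A v by (auto simp: E_def)
    have "\<zero> = F.lincomb a A i"
      using lc by simp
    also have "\<dots> = (\<Oplus>w\<in>A. a w \<otimes> w i)"
      unfolding F.lincomb_def using A E a
      by (subst finsum_free_module) (auto intro!: F.smult_closed[simplified])
    also have "\<dots> = (\<Oplus>w\<in>{v}. a w \<otimes> w i)"
    proof (rule add.finprod_mono_neutral_cong_right)
      fix w assume w: "w \<in> A - {v}"
      then obtain j where "w = single R j \<one>" using A by (auto simp: E_def)
      moreover have "j \<noteq> i" using w i calculation by auto
      moreover have "a w \<in> carrier R" using a w by auto
      ultimately show "a w \<otimes> w i = \<zero>" by (simp add: single_def)
    qed (use A a v E in \<open>auto simp: mem_free_module subset_iff Pi_iff\<close>)
    also have "\<dots> = a v"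
      using a v by (auto simp: i Pi_iff)
    finally show False using v by simp
  qed
  show "F.span (E I) = carrier (free_module R I)"
  proof
    show "F.span (E I) \<subseteq> carrier (free_module R I)"
      using F.span_is_subset2[OF E] .
    have sub: "submodule R (F.span (E I)) (free_module R I)"
      by (rule F.span_is_submodule[OF E])
    show "carrier (free_module R I) \<subseteq> F.span (E I)"
    proof
      fix f assume f: "f \<in> carrier (free_module R I)"
      then show "f \<in> F.span (E I)"
      proof (rule free_module_induct)
        fix i assume "i \<in> I"
        then have "single R i \<one> \<in> F.span (E I)"
          using F.in_own_span[OF E] by (auto simp: E_def)
        then have "f i \<odot>\<^bsub>free_module R I\<^esub> single R i \<one> \<in> F.span (E I)"
          using sub f by (simp only: submodule_def mem_free_module)
        moreover have "f i \<odot>\<^bsub>free_module R I\<^esub> single R i \<one> = single R i (f i)"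
          using f by (auto simp: single_def mem_free_module)
        ultimately show "single R i (f i) \<in> F.span (E I)"
          by simp
      qed (use sub in \<open>auto simp: submodule_def\<close>)
    qed
  qed
qed

section \<open>Graded modules over a PDCF domain\<close>

locale pdcf_domain =
  fixes k :: "('k, 'z) ring_scheme" and R :: "('k, 'r) module"
    and RG :: "'g :: ab_group_add \<Rightarrow> 'r set"
  assumes field_k: "field k" and graded_algebra_R: "graded_algebra k R RG"
    and domain_R: "domain R" and pdcf_R: "pdcf k R RG"
begin

abbreviation Q :: "'g set" where "Q \<equiv> graded_support R RG"

sublocale k: field k by (rule field_k)
sublocale R: domain R by (rule domain_R)
sublocale A: algebra k R using graded_algebra_R by (simp add: graded_algebra_def)

lemma submodule_RG: "submodule k (RG g) R"
  using graded_algebra_R by (simp add: graded_algebra_def graded_space_def subspace_def)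

lemma RG_closed: "a \<in> RG g \<Longrightarrow> a \<in> carrier R"
  and RG_zero [simp]: "\<zero>\<^bsub>R\<^esub> \<in> RG g"
  and RG_add: "a \<in> RG g \<Longrightarrow> b \<in> RG g \<Longrightarrow> a \<oplus>\<^bsub>R\<^esub> b \<in> RG g"
  and RG_smult: "c \<in> carrier k \<Longrightarrow> a \<in> RG g \<Longrightarrow> c \<odot>\<^bsub>R\<^esub> a \<in> RG g"
  using submodule_RG[of g] by (auto simp: submodule_def)

lemma RG_mult: "a \<in> RG g \<Longrightarrow> b \<in> RG h \<Longrightarrow> a \<otimes>\<^bsub>R\<^esub> b \<in> RG (g + h)"
  using graded_algebra_R by (simp add: graded_algebra_def)

lemma is_direct_sum_RG: "is_direct_sum R RG"
  using graded_algebra_R by (simp add: graded_algebra_def graded_space_def)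

lemma RG_0: "RG 0 = (\<lambda>c. c \<odot>\<^bsub>R\<^esub> \<one>\<^bsub>R\<^esub>) ` carrier k"
  using pdcf_R by (simp add: pdcf_def)

lemma RG_one: "\<one>\<^bsub>R\<^esub> \<in> RG 0"
  unfolding RG_0 by (intro image_eqI[of _ _ "\<one>\<^bsub>k\<^esub>"]) (simp_all add: A.smult_one)

lemma mem_support_iff: "g \<in> Q \<longleftrightarrow> (\<exists>a\<in>RG g. a \<noteq> \<zero>\<^bsub>R\<^esub>)"
  using RG_zero[of g] by (auto simp: graded_support_def simp del: RG_zero)

lemma zero_mem_Q: "0 \<in> Q"
  unfolding mem_support_iff using RG_one R.one_not_zero by blast

text \<open>The product of nonzero homogeneous elements is nonzero in a domain, so degrees of the
  support add up within it. Transitivity of the order rests on this.\<close>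

lemma add_mem_Q: "p \<in> Q \<Longrightarrow> q \<in> Q \<Longrightarrow> p + q \<in> Q"
  unfolding mem_support_iff using RG_mult R.integral_iff RG_closed by metis

lemma le_refl: "le_by Q g g"
  by (simp add: le_by_def zero_mem_Q)

lemma le_trans: "le_by Q f g \<Longrightarrow> le_by Q g h \<Longrightarrow> le_by Q f h"
  using add_mem_Q[of "g - f" "h - g"] by (simp add: le_by_def algebra_simps)

lemma le_antisym:
  assumes "le_by Q g h" and "le_by Q h g"
  shows "g = h"
proof -
  have "pointed Q"
    using pdcf_R by (simp add: pdcf_def)
  moreover have "(g - h) + (h - g) = 0"
    by simp
  ultimately show ?thesis
    using assms by (metis pointed_def le_by_def eq_iff_diff_eq_0)
qed

lemma downward_finite_Q: "downward_finite Q Q"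
  using pdcf_R by (simp add: pdcf_def)

end

locale pdcf_graded_module = pdcf_domain k R RG
  for k :: "('k, 'z) ring_scheme" and R :: "('k, 'r) module"
    and RG :: "'g :: ab_group_add \<Rightarrow> 'r set" +
  fixes N :: "('r, 'n) module" and NG :: "'g \<Rightarrow> 'n set"
  assumes graded_module_N: "graded_module k R RG N NG"
begin

sublocale N: module R N
  using graded_module_N by (simp add: graded_module_def)

lemma submodule_NG: "submodule k (NG g) (restrict_scalars R N)"
  and vectorspace_N: "vectorspace k (restrict_scalars R N)"
  using graded_module_N by (simp_all add: graded_module_def graded_space_def subspace_def)

lemma NG_closed: "x \<in> NG g \<Longrightarrow> x \<in> carrier N"
  and NG_zero [simp]: "\<zero>\<^bsub>N\<^esub> \<in> NG g"
  and NG_add: "x \<in> NG g \<Longrightarrow> y \<in> NG g \<Longrightarrow> x \<oplus>\<^bsub>N\<^esub> y \<in> NG g"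
  using submodule_NG[of g] by (auto simp: submodule_def)

lemma NG_smult: "a \<in> RG g \<Longrightarrow> x \<in> NG h \<Longrightarrow> a \<odot>\<^bsub>N\<^esub> x \<in> NG (g + h)"
  using graded_module_N by (simp add: graded_module_def)

lemma finsum_NG:
  assumes "finite A" and "\<And>i. i \<in> A \<Longrightarrow> f i \<in> NG g"
  shows "(\<Oplus>\<^bsub>N\<^esub>i\<in>A. f i) \<in> NG g"
  using assms
proof (induction A rule: finite_induct)
  case (insert i A)
  then show ?case
    by (subst N.finsum_insert) (auto intro: NG_closed NG_add)
qed simp

lemma is_direct_sum_NG: "is_direct_sum N NG"
  using graded_module_N
  by (simp add: graded_module_def graded_space_def)

end

section \<open>Graded submodules, kernels and bases of components\<close>

text \<open>The submodule keeps the grading of \<open>N\<close>: its component of degree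
  \<open>g\<close> is \<open>L \<inter> NG g\<close>. Only existence of a decomposition is demanded;
  uniqueness is inherited from \<open>N\<close>.\<close>

definition graded_submodule ::
    "('r, 'z) ring_scheme \<Rightarrow> ('r, 'm) module \<Rightarrow> ('g \<Rightarrow> 'm set) \<Rightarrow> 'm set \<Rightarrow> bool" where
  "graded_submodule R N NG L \<longleftrightarrow> submodule R L N \<and>
    (\<forall>x\<in>L. \<exists>A f. finite A \<and> (\<forall>g\<in>A. f g \<in> L \<inter> NG g) \<and> x = (\<Oplus>\<^bsub>N\<^esub>g\<in>A. f g))"

context pdcf_graded_module
begin

lemma graded_submodule_carrier: "graded_submodule R N NG (carrier N)"
  unfolding graded_submodule_def
proof (intro conjI ballI)
  show "submodule R (carrier N) N"
    by (auto simp: submodule_def intro: N.module_axioms)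
  fix x assume "x \<in> carrier N"
  then obtain f where f: "\<And>g. f g \<in> NG g" "finite {g. f g \<noteq> \<zero>\<^bsub>N\<^esub>}"
      "x = (\<Oplus>\<^bsub>N\<^esub>g\<in>{g. f g \<noteq> \<zero>\<^bsub>N\<^esub>}. f g)"
    using is_direct_sum_decompose[OF is_direct_sum_NG] by blast
  then show "\<exists>A f. finite A \<and> (\<forall>g\<in>A. f g \<in> carrier N \<inter> NG g) \<and> x = (\<Oplus>\<^bsub>N\<^esub>g\<in>A. f g)"
    using NG_closed by blast
qed

text \<open>Apply \<open>\<phi>\<close> to the decomposition of a kernel element: the images are
  homogeneous of distinct degrees with sum zero, so each vanishes, and every component already lies
  in the kernel.\<close>

lemma graded_submodule_kernel:
  assumes P: "pdcf_graded_module k R RG P PG" and hom: "mod_hom R N P \<phi>"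
    and graded: "\<And>g. \<phi> ` NG g \<subseteq> PG g"
  shows "graded_submodule R N NG (a_kernel N P \<phi>)"
  unfolding graded_submodule_def
proof (intro conjI ballI)
  interpret P: pdcf_graded_module k R RG P PG by (rule P)
  interpret mod_hom R N P \<phi> by (rule hom)
  have ker: "a_kernel N P \<phi> = ker"
    by (simp add: a_kernel_def' ker_def)
  show "submodule R (a_kernel N P \<phi>) N"
    unfolding ker by (rule ker_is_submodule)
  fix x assume x: "x \<in> a_kernel N P \<phi>"
  then have "x \<in> carrier N" by (simp add: a_kernel_def')
  then obtain f where f: "\<And>g. f g \<in> NG g" and fin: "finite {g. f g \<noteq> \<zero>\<^bsub>N\<^esub>}"
      and sum: "x = (\<Oplus>\<^bsub>N\<^esub>g\<in>{g. f g \<noteq> \<zero>\<^bsub>N\<^esub>}. f g)"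
    using is_direct_sum_decompose[OF is_direct_sum_NG] by blast
  have fc: "f g \<in> carrier N" for g
    using f NG_closed by blast
  have "(\<Oplus>\<^bsub>P\<^esub>g\<in>{g. f g \<noteq> \<zero>\<^bsub>N\<^esub>}. \<phi> (f g)) = \<zero>\<^bsub>P\<^esub>"
    using x hom_finsum[OF fin, of f] fc by (simp add: sum[symmetric] a_kernel_def')
  moreover have "\<phi> (f g) \<in> PG g" for g
    using f graded by blast
  ultimately have "\<phi> (f g) = \<zero>\<^bsub>P\<^esub>" if "f g \<noteq> \<zero>\<^bsub>N\<^esub>" for g
    using P.N.is_direct_sum_independent[OF P.is_direct_sum_NG, of "{g. f g \<noteq> \<zero>\<^bsub>N\<^esub>}" "\<lambda>g. \<phi> (f g)" g]
      that fin P.NG_closed by auto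
  then show "\<exists>A f. finite A \<and> (\<forall>g\<in>A. f g \<in> a_kernel N P \<phi> \<inter> NG g) \<and> x = (\<Oplus>\<^bsub>N\<^esub>g\<in>A. f g)"
    using f fc fin sum
    by (intro exI[of _ "{g. f g \<noteq> \<zero>\<^bsub>N\<^esub>}"] exI[of _ f]) (simp add: a_kernel_def')
qed

text \<open>A \<open>k\<close>-basis of one component. Connectedness identifies \<open>k\<close>
  with \<open>RG 0\<close>, and coefficients are taken there because they later arise as entries of
  elements of a free module over \<open>R\<close>.\<close>

lemma graded_submodule_component_basis:
  assumes fd: "locally_fin_dim k (restrict_scalars R N) NG" and L: "graded_submodule R N NG L"
  obtains A where "finite A" and "A \<subseteq> L \<inter> NG g"
    and "\<And>x. x \<in> L \<inter> NG g \<Longrightarrow> \<exists>a\<in>A \<rightarrow> RG 0. x = (\<Oplus>\<^bsub>N\<^esub>v\<in>A. a v \<odot>\<^bsub>N\<^esub> v)"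
    and "\<And>a v. a \<in> A \<rightarrow> RG 0 \<Longrightarrow> (\<Oplus>\<^bsub>N\<^esub>v\<in>A. a v \<odot>\<^bsub>N\<^esub> v) = \<zero>\<^bsub>N\<^esub> \<Longrightarrow> v \<in> A \<Longrightarrow> a v = \<zero>\<^bsub>R\<^esub>"
proof -
  let ?V = "restrict_scalars R N"
  interpret V: vectorspace k ?V by (rule vectorspace_N)
  have NGs: "submodule k (NG g) ?V" by (rule submodule_NG)
  interpret W: vectorspace k "V.vs (NG g)"
    by (rule V.subspace_is_vs) (use NGs in \<open>simp add: subspace_def vectorspace_N\<close>)
  have L': "submodule R L N" using L by (simp add: graded_submodule_def)
  \<comment> \<open>\<open>L\<close> is closed under the action of \<open>k\<close> because
    \<open>k\<close> acts through elements of \<open>R\<close>.\<close>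
  have sub: "submodule k (L \<inter> NG g) (V.vs (NG g))"
    using L' NGs W.module_axioms by (auto simp: submodule_def)
  have "W.fin_dim" using fd by (simp add: locally_fin_dim_def)
  then obtain A where A: "finite A" "A \<subseteq> L \<inter> NG g" "W.lin_indpt A" "W.span A = L \<inter> NG g"
    using W.finite_basis_of_subspace[OF _ sub] by blast
  have AN: "A \<subseteq> NG g" using A by blast
  have li: "V.lin_indpt A" and sp: "V.span A = L \<inter> NG g"
    using A V.span_li_not_depend[OF AN NGs] by auto
  have Ac: "A \<subseteq> carrier ?V" using AN NG_closed by auto
  show thesis
  proof (rule that[OF A(1,2)])
    fix x assume "x \<in> L \<inter> NG g"
    then obtain c where c: "c \<in> A \<rightarrow> carrier k" "x = V.lincomb c A"
      using V.finite_span[OF A(1) Ac] unfolding sp by blast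
    then show "\<exists>a\<in>A \<rightarrow> RG 0. x = (\<Oplus>\<^bsub>N\<^esub>v\<in>A. a v \<odot>\<^bsub>N\<^esub> v)"
      by (intro bexI[of _ "\<lambda>v. c v \<odot>\<^bsub>R\<^esub> \<one>\<^bsub>R\<^esub>"]) (auto simp: V.lincomb_def RG_0)
  next
    fix a v assume a: "a \<in> A \<rightarrow> RG 0" and 0: "(\<Oplus>\<^bsub>N\<^esub>v\<in>A. a v \<odot>\<^bsub>N\<^esub> v) = \<zero>\<^bsub>N\<^esub>" and v: "v \<in> A"
    have "\<forall>v\<in>A. \<exists>c\<in>carrier k. a v = c \<odot>\<^bsub>R\<^esub> \<one>\<^bsub>R\<^esub>"
      using a by (auto simp: RG_0)
    then obtain c where c: "\<And>v. v \<in> A \<Longrightarrow> c v \<in> carrier k" "\<And>v. v \<in> A \<Longrightarrow> a v = c v \<odot>\<^bsub>R\<^esub> \<one>\<^bsub>R\<^esub>"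
      by metis
    have "V.lincomb c A = (\<Oplus>\<^bsub>N\<^esub>v\<in>A. a v \<odot>\<^bsub>N\<^esub> v)"
      unfolding V.lincomb_def finsum_restrict_scalars
      by (rule N.finsum_cong') (use c Ac a RG_closed in \<open>auto simp: Pi_iff subset_iff\<close>)
    then have "c v = \<zero>\<^bsub>k\<^esub>"
      using li 0 v c A(1) unfolding V.lin_dep_def by auto
    then show "a v = \<zero>\<^bsub>R\<^esub>"
      using c v by simp
  qed
qed

end

section \<open>Graded free modules\<close>

text \<open>The direct sum of the shifts R(-deg i): the basis vector at \<open>i\<close> sits in
  degree \<open>deg i\<close>, so its coefficient in an element of degree \<open>g\<close> has
  degree \<open>g - deg i\<close>.\<close>

definition free_grading ::
    "('r, 'z) ring_scheme \<Rightarrow> ('g :: ab_group_add \<Rightarrow> 'r set) \<Rightarrow> ('i \<Rightarrow> 'g) \<Rightarrow> 'i set \<Rightarrow> 'g \<Rightarrow> ('i \<Rightarrow> 'r) set"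
  where "free_grading R RG deg I g = {f \<in> carrier (free_module R I). \<forall>i. f i \<in> RG (g - deg i)}"

context pdcf_domain
begin

lemma module_k_free_module: "module k (restrict_scalars R (free_module R I))"
  by (rule module_restrict_scalars[OF A.algebra_axioms R.module_free_module])

lemma smult_one_mult: "c \<in> carrier k \<Longrightarrow> a \<in> carrier R \<Longrightarrow> (c \<odot>\<^bsub>R\<^esub> \<one>\<^bsub>R\<^esub>) \<otimes>\<^bsub>R\<^esub> a = c \<odot>\<^bsub>R\<^esub> a"
  by (simp add: A.smult_assoc2)

lemma submodule_free_grading:
  "submodule k (free_grading R RG deg I g) (restrict_scalars R (free_module R I))"
proof -
  interpret F: module R "free_module R I" by (rule R.module_free_module)
  show ?thesis
    unfolding submodule_def
  proof (intro conjI allI impI)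
    fix c f assume c: "c \<in> carrier k" and f: "f \<in> free_grading R RG deg I g"
    have "(c \<odot>\<^bsub>R\<^esub> \<one>\<^bsub>R\<^esub>) \<odot>\<^bsub>free_module R I\<^esub> f \<in> carrier (free_module R I)"
      using c f by (intro F.smult_closed) (auto simp: free_grading_def)
    moreover have "f i \<in> carrier R" for i
      using f by (auto simp: free_grading_def R.mem_free_module)
    ultimately show "c \<odot>\<^bsub>restrict_scalars R (free_module R I)\<^esub> f \<in> free_grading R RG deg I g"
      using c f by (auto simp: free_grading_def smult_one_mult intro: RG_smult)
  next
    fix f f' assume f: "f \<in> free_grading R RG deg I g" "f' \<in> free_grading R RG deg I g"
    then have "f \<oplus>\<^bsub>free_module R I\<^esub> f' \<in> carrier (free_module R I)"
      by (intro F.a_closed) (auto simp: free_grading_def)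
    then show "f \<oplus>\<^bsub>restrict_scalars R (free_module R I)\<^esub> f' \<in> free_grading R RG deg I g"
      using f by (auto simp: free_grading_def intro: RG_add)
  qed (use module_k_free_module in \<open>auto simp: free_grading_def R.mem_free_module\<close>)
qed

lemma vectorspace_free_module: "vectorspace k (restrict_scalars R (free_module R I))"
  by (simp add: vectorspace_def module_k_free_module field_k)

lemma single_mem_free_grading:
  "i \<in> I \<Longrightarrow> a \<in> RG q \<Longrightarrow> single R i a \<in> free_grading R RG deg I (q + deg i)"
  by (auto simp: free_grading_def single_def RG_closed intro!: R.single_mem_free_module[unfolded single_def])

text \<open>Everything happens coordinatewise: at coordinate \<open>i\<close>, total degree
  \<open>g\<close> corresponds to degree \<open>g - deg i\<close> of \<open>R\<close>, where the
  direct sum property is known.\<close>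

lemma is_direct_sum_free_grading: "is_direct_sum (free_module R I) (free_grading R RG deg I)"
proof -
  interpret F: module R "free_module R I" by (rule R.module_free_module)
  interpret V: vectorspace k "restrict_scalars R (free_module R I)"
    by (rule vectorspace_free_module)
  let ?F = "free_module R I" and ?FG = "free_grading R RG deg I"
  have closed: "f i \<in> carrier R" if "f \<in> carrier ?F" for f i
    using that by (simp add: R.mem_free_module)
  show ?thesis
  proof (rule F.is_direct_sumI)
    fix x :: "'a \<Rightarrow> 'r" assume x: "x \<in> carrier ?F"
    show "\<exists>A f. finite A \<and> (\<forall>g. f g \<in> ?FG g) \<and> x = (\<Oplus>\<^bsub>?F\<^esub>g\<in>A. f g)"
    proof -
      have "\<exists>c. (\<forall>q. c q \<in> RG q) \<and> finite {q. c q \<noteq> \<zero>\<^bsub>R\<^esub>} \<and>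
          x i = (\<Oplus>\<^bsub>R\<^esub>q\<in>{q. c q \<noteq> \<zero>\<^bsub>R\<^esub>}. c q)" for i
        using is_direct_sum_decompose[OF is_direct_sum_RG closed[OF x, of i]] by metis
      then obtain c where c: "\<And>i q. c i q \<in> RG q" and fin: "\<And>i. finite {q. c i q \<noteq> \<zero>\<^bsub>R\<^esub>}"
        and sum: "\<And>i. x i = (\<Oplus>\<^bsub>R\<^esub>q\<in>{q. c i q \<noteq> \<zero>\<^bsub>R\<^esub>}. c i q)"
        by metis
      define S where "S = {i. x i \<noteq> \<zero>\<^bsub>R\<^esub>}"
      have S: "finite S" "S \<subseteq> I"
        using x by (auto simp: S_def R.mem_free_module)
      \<comment> \<open>All total degrees that occur: the piece of degree \<open>q\<close> of the
        coordinate \<open>i\<close> has total degree \<open>q + deg i\<close>.\<close>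
      define A where "A = (\<Union>i\<in>S. (\<lambda>q. q + deg i) ` {q. c i q \<noteq> \<zero>\<^bsub>R\<^esub>})"
      define f where "f = (\<lambda>g i. if i \<in> S then c i (g - deg i) else \<zero>\<^bsub>R\<^esub>)"
      have A: "finite A"
        using S fin by (simp add: A_def)
      have f: "f g \<in> ?FG g" for g
      proof -
        have "finite {i. f g i \<noteq> \<zero>\<^bsub>R\<^esub>}"
          by (rule finite_subset[OF _ S(1)]) (auto simp: f_def)
        then show ?thesis
          using c RG_closed[OF c] S by (auto simp: free_grading_def R.mem_free_module f_def)
      qed
      then have fc: "f g \<in> carrier ?F" for g
        by (auto simp: free_grading_def)
      have "x i = (\<Oplus>\<^bsub>?F\<^esub>g\<in>A. f g) i" for i
      proof (cases "i \<in> S")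
        case True
        have "(\<Oplus>\<^bsub>?F\<^esub>g\<in>A. f g) i = (\<Oplus>\<^bsub>R\<^esub>g\<in>A. c i (g - deg i))"
          using R.finsum_free_module[OF A, of f I i] fc True by (simp add: f_def)
        also have "\<dots> = (\<Oplus>\<^bsub>R\<^esub>g\<in>(\<lambda>q. q + deg i) ` {q. c i q \<noteq> \<zero>\<^bsub>R\<^esub>}. c i (g - deg i))"
        proof (rule R.add.finprod_mono_neutral_cong_right)
          fix g assume g: "g \<in> A - (\<lambda>q. q + deg i) ` {q. c i q \<noteq> \<zero>\<^bsub>R\<^esub>}"
          then show "c i (g - deg i) = \<zero>\<^bsub>R\<^esub>"
            by (auto simp: image_iff dest!: spec[of _ "g - deg i"])
        qed (use A True c RG_closed in \<open>auto simp: A_def\<close>)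
        also have "\<dots> = (\<Oplus>\<^bsub>R\<^esub>q\<in>{q. c i q \<noteq> \<zero>\<^bsub>R\<^esub>}. c i q)"
          using c RG_closed by (subst R.add.finprod_reindex) (auto simp: inj_on_def)
        finally show ?thesis using sum by simp
      next
        case False
        then show ?thesis
          using R.finsum_free_module[OF A, of f I i] fc by (simp add: f_def S_def)
      qed
      then have "x = (\<Oplus>\<^bsub>?F\<^esub>g\<in>A. f g)" by blast
      then show ?thesis using A f by blast
    qed
  next
    fix A f g
    assume A: "finite A" and f: "\<And>g. f g \<in> ?FG g" and sum: "(\<Oplus>\<^bsub>?F\<^esub>g\<in>A. f g) = \<zero>\<^bsub>?F\<^esub>" and g: "g \<in> A"
    have fc: "f g \<in> carrier ?F" for g
      using f by (auto simp: free_grading_def)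
    have "f g i = \<zero>\<^bsub>R\<^esub>" for i
    proof -
      have "(\<Oplus>\<^bsub>R\<^esub>g\<in>A. f g i) = \<zero>\<^bsub>R\<^esub>"
        using R.finsum_free_module[OF A, of f I i] fc sum by simp
      \<comment> \<open>Reindexed by degrees of \<open>R\<close>, so that independence of the
        components of \<open>R\<close> applies.\<close>
      moreover have "(\<Oplus>\<^bsub>R\<^esub>g\<in>A. f g i) = (\<Oplus>\<^bsub>R\<^esub>q\<in>(\<lambda>g. g - deg i) ` A. f (q + deg i) i)"
        using closed[OF fc] by (subst R.add.finprod_reindex) (auto simp: inj_on_def)
      ultimately have "(\<Oplus>\<^bsub>R\<^esub>q\<in>(\<lambda>g. g - deg i) ` A. f (q + deg i) i) = \<zero>\<^bsub>R\<^esub>"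
        by simp
      then have "f ((g - deg i) + deg i) i = \<zero>\<^bsub>R\<^esub>"
      proof (rule R.is_direct_sum_independent[OF is_direct_sum_RG, rotated 4])
        fix q show "f (q + deg i) i \<in> RG q"
          using f[of "q + deg i"] by (auto simp: free_grading_def dest!: spec[of _ i])
      qed (use A g RG_closed in auto)
      then show ?thesis by simp
    qed
    then show "f g = \<zero>\<^bsub>?F\<^esub>" by auto
  next
    fix g x y assume *: "x \<in> ?FG g" "y \<in> ?FG g"
    have "\<ominus>\<^bsub>?F\<^esub> y \<in> ?FG g"
      using V.submodule_uminus[OF submodule_free_grading *(2)] by simp
    then show "x \<ominus>\<^bsub>?F\<^esub> y \<in> ?FG g"
      using * submodule_free_grading[of deg I g] by (auto simp: a_minus_def submodule_def)
  qed (auto simp: free_grading_def R.mem_free_module)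
qed

lemma graded_module_free_module:
  "graded_module k R RG (free_module R I) (free_grading R RG deg I)"
  unfolding graded_module_def
proof (intro conjI allI ballI)
  show "module R (free_module R I)" by (rule R.module_free_module)
  then interpret F: module R "free_module R I" .
  show "graded_space k (restrict_scalars R (free_module R I)) (free_grading R RG deg I)"
    by (simp add: graded_space_def subspace_def vectorspace_free_module submodule_free_grading
        is_direct_sum_free_grading)
  fix g h a f assume a: "a \<in> RG g" and f: "f \<in> free_grading R RG deg I h"
  have "a \<odot>\<^bsub>free_module R I\<^esub> f \<in> carrier (free_module R I)"
    using a f RG_closed by (intro F.smult_closed) (auto simp: free_grading_def)
  moreover have "a \<otimes>\<^bsub>R\<^esub> f i \<in> RG (g + h - deg i)" for i
    using RG_mult[OF a, of "f i" "h - deg i"] f by (simp add: free_grading_def add_diff_eq)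
  ultimately show "a \<odot>\<^bsub>free_module R I\<^esub> f \<in> free_grading R RG deg I (g + h)"
    by (simp add: free_grading_def)
qed

lemma graded_free_free_module: "graded_free R (free_module R I) (free_grading R RG deg I)"
proof -
  let ?E = "(\<lambda>i. single R i \<one>\<^bsub>R\<^esub>) ` I"
  have "single R i \<one>\<^bsub>R\<^esub> \<in> free_grading R RG deg I (0 + deg i)" if "i \<in> I" for i
    by (rule single_mem_free_grading[OF that RG_one])
  then have "\<forall>e\<in>?E. \<exists>g. e \<in> free_grading R RG deg I g"
    by blast
  moreover have "?E \<subseteq> carrier (free_module R I)"
    by (rule image_subsetI) (simp add: R.single_mem_free_module)
  ultimately show ?thesis
    unfolding graded_free_def
    using R.free_module_basis[of I] by (intro exI[of _ ?E] conjI)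
qed

text \<open>Degree \<open>g\<close> only involves the indices with \<open>deg i\<close> below
  \<open>g\<close>. There are finitely many, and each contributes a copy of the finite-dimensional
  component of degree \<open>g - deg i\<close>.\<close>

lemma locally_fin_dim_free_module:
  assumes fin: "\<And>g. finite {i \<in> I. le_by Q (deg i) g}"
  shows "locally_fin_dim k (restrict_scalars R (free_module R I)) (free_grading R RG deg I)"
  unfolding locally_fin_dim_def
proof
  fix g
  let ?F = "free_module R I" and ?FG = "free_grading R RG deg I g"
  interpret V: vectorspace k "restrict_scalars R ?F" by (rule vectorspace_free_module)
  interpret W: vectorspace k "V.vs ?FG"
    by (rule V.subspace_is_vs) (simp add: subspace_def vectorspace_free_module submodule_free_grading)
  have "vectorspace k R"
    by (simp add: vectorspace_def field_k A.module_axioms)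
  then interpret VR: vectorspace k R .
  define D where "D = {i \<in> I. le_by Q (deg i) g}"
  have "\<exists>B. finite B \<and> B \<subseteq> RG q \<and> A.span B = RG q" for q
  proof -
    interpret Wq: vectorspace k "R\<lparr>carrier := RG q\<rparr>"
      by (rule VR.subspace_is_vs) (simp add: subspace_def VR.vectorspace_axioms submodule_RG)
    have "Wq.fin_dim"
      using pdcf_R by (simp add: pdcf_def locally_fin_dim_def)
    then obtain B where "finite B" "B \<subseteq> RG q" "Wq.span B = RG q"
      by (auto simp: Wq.fin_dim_def)
    then show ?thesis
      using A.span_li_not_depend(1)[OF _ submodule_RG] by metis
  qed
  then obtain B where B: "\<And>q. finite (B q)" "\<And>q. B q \<subseteq> RG q" "\<And>q. A.span (B q) = RG q"
    by metis
  define S where "S = (\<Union>i\<in>D. single R i ` B (g - deg i))"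
  have S: "finite S"
    using fin B by (simp add: S_def D_def)
  have SF: "S \<subseteq> ?FG"
  proof
    fix s assume "s \<in> S"
    then obtain i b where "i \<in> D" "b \<in> B (g - deg i)" "s = single R i b"
      by (auto simp: S_def)
    then show "s \<in> ?FG"
      using single_mem_free_grading[of i I b "g - deg i" deg] B(2) by (auto simp: D_def)
  qed
  then have SF': "S \<subseteq> carrier (V.vs ?FG)" by simp
  have sub: "submodule k (W.span S) (V.vs ?FG)"
    by (rule W.span_is_submodule[OF SF'])
  have single_mem: "single R i a \<in> W.span S" if i: "i \<in> D" and a: "a \<in> RG (g - deg i)" for i a
  proof -
    \<comment> \<open>The preimage of the span under \<open>single R i\<close> is a subspace of
      \<open>R\<close>. It contains the spanning set \<open>B (g - deg i)\<close>, hence the whole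
      component.\<close>
    let ?H = "{a \<in> carrier R. single R i a \<in> W.span S}"
    have "submodule k ?H R"
      unfolding submodule_def
    proof (intro conjI allI impI)
      fix a b assume "a \<in> ?H" "b \<in> ?H"
      moreover have "single R i (a \<oplus>\<^bsub>R\<^esub> b) = (\<lambda>j. single R i a j \<oplus>\<^bsub>R\<^esub> single R i b j)"
        by (auto simp: single_def)
      ultimately show "a \<oplus>\<^bsub>R\<^esub> b \<in> ?H"
        using sub by (auto simp: submodule_def)
    next
      fix c a assume c: "c \<in> carrier k" and a: "a \<in> ?H"
      then have "c \<odot>\<^bsub>V.vs ?FG\<^esub> single R i a \<in> W.span S"
        using sub by (simp add: submodule_def)
      moreover have "c \<odot>\<^bsub>V.vs ?FG\<^esub> single R i a = single R i (c \<odot>\<^bsub>R\<^esub> a)"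
        using c a by (auto simp: single_def smult_one_mult)
      ultimately show "c \<odot>\<^bsub>R\<^esub> a \<in> ?H"
        using c a by simp
    qed (use sub in \<open>auto simp: submodule_def A.module_axioms\<close>)
    moreover have "B (g - deg i) \<subseteq> ?H"
      using i W.in_own_span[OF SF'] B(2) RG_closed by (fastforce simp: S_def)
    ultimately have "A.span (B (g - deg i)) \<subseteq> ?H"
      by (intro A.span_is_subset)
    then show ?thesis
      using a B by auto
  qed
  have "f \<in> W.span S" if f: "f \<in> ?FG" for f
  proof -
    have "f \<in> carrier ?F" using f by (simp add: free_grading_def)
    then show ?thesis
    proof (rule R.free_module_induct)
      fix i assume i: "i \<in> I"
      have fi: "f i \<in> RG (g - deg i)"
        using f by (simp add: free_grading_def)
      show "single R i (f i) \<in> W.span S"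
      proof (cases "f i = \<zero>\<^bsub>R\<^esub>")
        case True
        then show ?thesis using sub by (simp add: submodule_def)
      next
        case False
        then have "i \<in> D"
          using fi i by (auto simp: D_def le_by_def mem_support_iff)
        then show ?thesis using single_mem fi by blast
      qed
    qed (use sub in \<open>auto simp: submodule_def\<close>)
  qed
  then have "W.span S = carrier (V.vs ?FG)"
    using sub by (auto simp: submodule_def)
  then show "vectorspace.fin_dim k (restrict_scalars R ?F\<lparr>carrier := ?FG\<rparr>)"
    unfolding W.fin_dim_def using S SF' by blast
qed

end

section \<open>Free covers\<close>

context pdcf_graded_module
begin

text \<open>The index (g, j) stands for the j-th basis vector of the component of \<open>L\<close>
  in degree \<open>g\<close>. Numbering the vectors keeps the index type independent of the type of
  \<open>N\<close>, so the same statement serves \<open>M\<close> and all its syzygies.\<close>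

lemma graded_free_cover:
  assumes fd: "locally_fin_dim k (restrict_scalars R N) NG" and L: "graded_submodule R N NG L"
  obtains B :: "('g \<times> nat) set" and \<phi> where
    "\<And>b. b \<in> B \<Longrightarrow> L \<inter> NG (fst b) \<noteq> {\<zero>\<^bsub>N\<^esub>}"
    and "\<And>g. finite {b \<in> B. fst b = g}"
    and "graded_map R (free_module R B) (free_grading R RG fst B) N NG \<phi>"
    and "\<phi> ` carrier (free_module R B) = L"
    and "\<And>g. a_kernel (free_module R B) N \<phi> \<inter> free_grading R RG fst B g \<noteq> {\<zero>\<^bsub>free_module R B\<^esub>} \<Longrightarrow>
      \<exists>h. L \<inter> NG h \<noteq> {\<zero>\<^bsub>N\<^esub>} \<and> le_by Q h g \<and> h \<noteq> g"
proof -
  \<comment> \<open>Bundled into one predicate, so that bases can be chosen for all degrees at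
    once.\<close>
  define good where "good g A \<longleftrightarrow> finite A \<and> A \<subseteq> L \<inter> NG g \<and>
      (\<forall>x\<in>L \<inter> NG g. \<exists>a\<in>A \<rightarrow> RG 0. x = (\<Oplus>\<^bsub>N\<^esub>v\<in>A. a v \<odot>\<^bsub>N\<^esub> v)) \<and>
      (\<forall>a\<in>A \<rightarrow> RG 0. (\<Oplus>\<^bsub>N\<^esub>v\<in>A. a v \<odot>\<^bsub>N\<^esub> v) = \<zero>\<^bsub>N\<^esub> \<longrightarrow> (\<forall>v\<in>A. a v = \<zero>\<^bsub>R\<^esub>))" for g A
  have "\<exists>A. good g A" for g
  proof (rule graded_submodule_component_basis[OF fd L, of g])
    fix A
    assume 1: "finite A" "A \<subseteq> L \<inter> NG g"
      and 2: "\<And>x. x \<in> L \<inter> NG g \<Longrightarrow> \<exists>a\<in>A \<rightarrow> RG 0. x = (\<Oplus>\<^bsub>N\<^esub>v\<in>A. a v \<odot>\<^bsub>N\<^esub> v)"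
      and 3: "\<And>a v. a \<in> A \<rightarrow> RG 0 \<Longrightarrow> (\<Oplus>\<^bsub>N\<^esub>v\<in>A. a v \<odot>\<^bsub>N\<^esub> v) = \<zero>\<^bsub>N\<^esub> \<Longrightarrow> v \<in> A \<Longrightarrow> a v = \<zero>\<^bsub>R\<^esub>"
    have "good g A"
      unfolding good_def by (intro conjI ballI impI 1 2 3)
    then show "\<exists>A. good g A" ..
  qed
  then obtain A where good: "\<And>g. good g (A g)"
    by metis
  have finA: "finite (A g)" and AL: "A g \<subseteq> L \<inter> NG g" for g
    using good[of g] by (simp_all only: good_def)
  have gen: "\<exists>a\<in>A g \<rightarrow> RG 0. x = (\<Oplus>\<^bsub>N\<^esub>v\<in>A g. a v \<odot>\<^bsub>N\<^esub> v)" if "x \<in> L \<inter> NG g" for g x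
    using good[of g] that unfolding good_def by (elim conjE) (rule bspec)
  have indep: "a v = \<zero>\<^bsub>R\<^esub>"
    if "a \<in> A g \<rightarrow> RG 0" "(\<Oplus>\<^bsub>N\<^esub>v\<in>A g. a v \<odot>\<^bsub>N\<^esub> v) = \<zero>\<^bsub>N\<^esub>" "v \<in> A g" for g a v
    using good[of g] that unfolding good_def by simp
  have "\<exists>e. bij_betw e {0..<card (A g)} (A g)" for g
    by (rule ex_bij_betw_nat_finite[OF finA])
  then obtain e where e: "\<And>g. bij_betw (e g) {0..<card (A g)} (A g)"
    by metis
  define B where "B = {b. snd b < card (A (fst b))}"
  define \<beta> where "\<beta> = (\<lambda>b. e (fst b) (snd b))"
  define D where "D = (\<lambda>g. {b \<in> B. fst b = g})"
  have D: "D g = Pair g ` {0..<card (A g)}" for g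
    by (auto simp: D_def B_def)
  have bij: "bij_betw \<beta> (D g) (A g)" for g
  proof -
    have "bij_betw (\<beta> \<circ> Pair g) {0..<card (A g)} (A g)"
      using e[of g] by (simp add: \<beta>_def comp_def)
    then show ?thesis
      unfolding D by (subst bij_betw_comp_iff[of "Pair g"]) (auto simp: bij_betw_def inj_on_def)
  qed
  have \<beta>: "\<beta> b \<in> A (fst b)" if "b \<in> B" for b
    by (rule bij_betw_apply[OF bij[of "fst b"]]) (use that in \<open>simp add: D_def\<close>)
  have L': "submodule R L N" and LN: "L \<subseteq> carrier N"
    using L by (simp_all add: graded_submodule_def submodule_def)
  have \<beta>N: "\<beta> \<in> B \<rightarrow> carrier N"
    using \<beta> AL LN by blast
  let ?F = "free_module R B" and ?FG = "free_grading R RG fst B"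
  define \<phi> where "\<phi> = free_ext R N \<beta>"
  interpret mod_hom R ?F N \<phi>
    unfolding \<phi>_def by (rule N.mod_hom_free_ext[OF \<beta>N])
  have \<phi>_eq: "\<phi> f = (\<Oplus>\<^bsub>N\<^esub>b\<in>{b. f b \<noteq> \<zero>\<^bsub>R\<^esub>}. f b \<odot>\<^bsub>N\<^esub> \<beta> b)" for f
    by (simp add: \<phi>_def free_ext_def)
  have supp: "finite {b. f b \<noteq> \<zero>\<^bsub>R\<^esub>}" "{b. f b \<noteq> \<zero>\<^bsub>R\<^esub>} \<subseteq> B" "f b \<in> carrier R"
    if "f \<in> carrier ?F" for f b
    using that unfolding R.mem_free_module by blast+
  have nz: "L \<inter> NG (fst b) \<noteq> {\<zero>\<^bsub>N\<^esub>}" if b: "b \<in> B" for b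
  proof
    assume "L \<inter> NG (fst b) = {\<zero>\<^bsub>N\<^esub>}"
    then have "A (fst b) \<subseteq> {\<zero>\<^bsub>N\<^esub>}"
      using AL by blast
    \<comment> \<open>If all basis vectors in this degree were zero, the coefficients 1 would form a
      nontrivial relation.\<close>
    then have "(\<Oplus>\<^bsub>N\<^esub>v\<in>A (fst b). \<one>\<^bsub>R\<^esub> \<odot>\<^bsub>N\<^esub> v) = (\<Oplus>\<^bsub>N\<^esub>v\<in>A (fst b). \<zero>\<^bsub>N\<^esub>)"
      by (intro N.finsum_cong') auto
    then have "\<one>\<^bsub>R\<^esub> = \<zero>\<^bsub>R\<^esub>"
      using indep[of "\<lambda>_. \<one>\<^bsub>R\<^esub>" "fst b"] \<beta>[OF b] RG_one by (simp add: N.finsum_zero)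
    then show False
      using R.one_not_zero by blast
  qed
  have graded: "\<phi> f \<in> NG g" if f: "f \<in> ?FG g" for f g
    unfolding \<phi>_eq
  proof (rule finsum_NG)
    have fF: "f \<in> carrier ?F" using f by (simp add: free_grading_def)
    then show "finite {b. f b \<noteq> \<zero>\<^bsub>R\<^esub>}" by (rule supp)
    fix b assume "b \<in> {b. f b \<noteq> \<zero>\<^bsub>R\<^esub>}"
    then have "\<beta> b \<in> NG (fst b)"
      using supp[OF fF] \<beta> AL by blast
    moreover have "f b \<in> RG (g - fst b)"
      using f unfolding free_grading_def by blast
    ultimately show "f b \<odot>\<^bsub>N\<^esub> \<beta> b \<in> NG g"
      using NG_smult[of "f b" "g - fst b" "\<beta> b" "fst b"] by simp
  qed
  have im_L: "\<phi> ` carrier ?F \<subseteq> L"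
  proof
    fix x assume "x \<in> \<phi> ` carrier ?F"
    then obtain f where f: "f \<in> carrier ?F" and x: "x = \<phi> f" by blast
    show "x \<in> L"
      unfolding x \<phi>_eq
    proof (rule N.finsum_mem_submodule[OF L' supp(1)[OF f]])
      fix b assume "b \<in> {b. f b \<noteq> \<zero>\<^bsub>R\<^esub>}"
      then have "\<beta> b \<in> L"
        using supp(2)[OF f] \<beta> AL by blast
      then show "f b \<odot>\<^bsub>N\<^esub> \<beta> b \<in> L"
        using L' supp(3)[OF f] by (simp add: submodule_def)
    qed
  qed
  have L_im: "L \<subseteq> im"
  proof
    have A_im: "v \<in> im" if v: "v \<in> A g" for v g
    proof -
      have "v \<in> \<beta> ` D g"
        using v bij[of g] by (simp add: bij_betw_def)
      then obtain b where b: "b \<in> B" "v = \<beta> b"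
        unfolding D_def by blast
      have "\<phi> (single R b \<one>\<^bsub>R\<^esub>) = v"
        unfolding \<phi>_def using b \<beta>N by (simp add: N.free_ext_single[OF \<beta>N] Pi_iff)
      moreover have "single R b \<one>\<^bsub>R\<^esub> \<in> carrier ?F"
        using b by (simp add: R.single_mem_free_module)
      ultimately show ?thesis
        unfolding im_def by blast
    qed
    have hom_im: "x \<in> im" if x: "x \<in> L \<inter> NG g" for x g
    proof -
      obtain a where a: "a \<in> A g \<rightarrow> RG 0" "x = (\<Oplus>\<^bsub>N\<^esub>v\<in>A g. a v \<odot>\<^bsub>N\<^esub> v)"
        using gen[OF x] by blast
      show ?thesis
        unfolding a(2)
      proof (rule N.finsum_mem_submodule[OF im_is_submodule finA])
        fix v assume v: "v \<in> A g"
        then have "a v \<in> carrier R" using a(1) RG_closed by blast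
        then show "a v \<odot>\<^bsub>N\<^esub> v \<in> im"
          using im_is_submodule A_im[OF v] by (simp add: submodule_def)
      qed
    qed
    fix x assume "x \<in> L"
    then obtain G f where G: "finite G" "\<And>g. g \<in> G \<Longrightarrow> f g \<in> L \<inter> NG g" "x = (\<Oplus>\<^bsub>N\<^esub>g\<in>G. f g)"
      using L unfolding graded_submodule_def by blast
    show "x \<in> im"
      unfolding G(3) by (rule N.finsum_mem_submodule[OF im_is_submodule G(1)]) (rule hom_im[OF G(2)])
  qed
  have ker: "\<exists>h. L \<inter> NG h \<noteq> {\<zero>\<^bsub>N\<^esub>} \<and> le_by Q h g \<and> h \<noteq> g"
    if K: "a_kernel ?F N \<phi> \<inter> ?FG g \<noteq> {\<zero>\<^bsub>?F\<^esub>}" for g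
  proof (rule ccontr)
    assume neg: "\<not> ?thesis"
    have "(\<lambda>_. \<zero>\<^bsub>R\<^esub>) \<in> a_kernel ?F N \<phi> \<inter> ?FG g"
      using M.M.zero_closed f0_is_0 by (simp add: a_kernel_def' free_grading_def)
    then obtain f where f: "f \<in> a_kernel ?F N \<phi>" "f \<in> ?FG g" "f \<noteq> (\<lambda>_. \<zero>\<^bsub>R\<^esub>)"
      using K by auto
    have fF: "f \<in> carrier ?F" and f0: "\<phi> f = \<zero>\<^bsub>N\<^esub>"
      using f(1) by (simp_all add: a_kernel_def')
    have fg: "f b \<in> RG (g - fst b)" for b
      using f(2) unfolding free_grading_def by blast
    \<comment> \<open>A nonzero entry at \<open>b\<close> puts \<open>fst b\<close> below
      \<open>g\<close>, and \<open>L\<close> is nonzero in degree \<open>fst b\<close>. By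
      \<open>neg\<close> this degree can only be \<open>g\<close> itself.\<close>
    have sD: "{b. f b \<noteq> \<zero>\<^bsub>R\<^esub>} \<subseteq> D g"
    proof
      fix b assume b: "b \<in> {b. f b \<noteq> \<zero>\<^bsub>R\<^esub>}"
      then have bB: "b \<in> B" using supp(2)[OF fF] by blast
      have "le_by Q (fst b) g"
        using b fg[of b] by (auto simp: le_by_def mem_support_iff)
      then have "fst b = g"
        using neg nz[OF bB] by blast
      then show "b \<in> D g" using bB by (simp add: D_def)
    qed
    have finD: "finite (D g)" by (simp add: D)
    \<comment> \<open>The entries of \<open>f\<close> carried over to the basis \<open>A g\<close>.
      They have degree \<open>g - g\<close>, so they lie in \<open>RG 0\<close>, and the relation
      \<open>\<phi> f = 0\<close> becomes one that \<open>indep\<close> refutes.\<close>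
    define a where "a = (\<lambda>v. f (inv_into (D g) \<beta> v))"
    have a\<beta>: "a (\<beta> b) = f b" if "b \<in> D g" for b
      using bij[of g] that by (simp add: a_def bij_betw_def inv_into_f_f)
    have fD: "f b \<in> RG 0" if "b \<in> D g" for b
      using fg[of b] that by (simp add: D_def)
    have aA: "a \<in> A g \<rightarrow> RG 0"
    proof
      fix v assume "v \<in> A g"
      then have "v \<in> \<beta> ` D g"
        using bij[of g] by (simp add: bij_betw_def)
      then obtain b where "b \<in> D g" "v = \<beta> b"
        by blast
      then show "a v \<in> RG 0" using a\<beta> fD by simp
    qed
    have Ac: "v \<in> carrier N" if "v \<in> A g" for v
      using that AL LN by blast
    have av: "a v \<odot>\<^bsub>N\<^esub> v \<in> carrier N" if "v \<in> A g" for v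
      using that aA Ac RG_closed by (intro N.smult_closed) blast+
    have img: "\<beta> ` D g = A g"
      using bij[of g] by (simp add: bij_betw_def)
    have "\<zero>\<^bsub>N\<^esub> = (\<Oplus>\<^bsub>N\<^esub>b\<in>D g. f b \<odot>\<^bsub>N\<^esub> \<beta> b)"
      unfolding f0[symmetric] \<phi>_def
      by (rule N.free_ext_eq_finsum[OF fF \<beta>N finD sD]) (simp add: D_def)
    also have "\<dots> = (\<Oplus>\<^bsub>N\<^esub>b\<in>D g. a (\<beta> b) \<odot>\<^bsub>N\<^esub> \<beta> b)"
      by (rule N.finsum_cong') (use av img a\<beta> in auto)
    also have "\<dots> = (\<Oplus>\<^bsub>N\<^esub>v\<in>A g. a v \<odot>\<^bsub>N\<^esub> v)"
      by (rule N.add.finprod_reindex_bij_betw[OF bij, of "\<lambda>v. a v \<odot>\<^bsub>N\<^esub> v"])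
        (use av img in auto)
    finally have "a v = \<zero>\<^bsub>R\<^esub>" if "v \<in> A g" for v
      using indep[OF aA _ that] by simp
    then have "f b = \<zero>\<^bsub>R\<^esub>" if "b \<in> D g" for b
      using a\<beta>[OF that] img that by force
    then have "f = (\<lambda>_. \<zero>\<^bsub>R\<^esub>)"
      using sD by blast
    then show False using f(3) by blast
  qed
  show thesis
  proof (rule that[of B \<phi>])
    show "finite {b \<in> B. fst b = g}" for g
      using D[of g] by (simp add: D_def)
    show "graded_map R ?F ?FG N NG \<phi>"
      unfolding graded_map_def using graded f_hom by blast
    show "\<phi> ` carrier ?F = L"
      using im_L L_im by (auto simp: im_def)
  qed (use nz ker in auto)
qed

end

section \<open>Degree bounds and the resolution\<close>

lemma finitely_bounded_below_mono:
  "finitely_bounded_below Q U \<Longrightarrow> V \<subseteq> U \<Longrightarrow> finitely_bounded_below Q V"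
  unfolding finitely_bounded_below_def by blast

lemma downward_finite_mono:
  "downward_finite Q U \<Longrightarrow> V \<subseteq> U \<Longrightarrow> downward_finite Q V"
  unfolding downward_finite_def by (blast intro: rev_finite_subset)

context pdcf_domain
begin

text \<open>Translation by -p: an element between \<open>p\<close> and \<open>g\<close> corresponds
  to an element of \<open>Q\<close> below \<open>g - p\<close>, and there are finitely many of
  those.\<close>

lemma downward_finite_up_closure:
  assumes "finite P"
  shows "downward_finite Q {u. \<exists>p\<in>P. le_by Q p u}"
  unfolding downward_finite_def
proof
  fix g
  have "{u \<in> {u. \<exists>p\<in>P. le_by Q p u}. le_by Q u g} \<subseteq> (\<Union>p\<in>P. (+) p ` {q \<in> Q. le_by Q q (g - p)})"
  proof
    fix u assume "u \<in> {u \<in> {u. \<exists>p\<in>P. le_by Q p u}. le_by Q u g}"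
    then obtain p where "p \<in> P" "le_by Q p u" "le_by Q u g" by blast
    then have "p \<in> P" "u - p \<in> Q" "le_by Q (u - p) (g - p)" "u = p + (u - p)"
      by (simp_all add: le_by_def)
    then show "u \<in> (\<Union>p\<in>P. (+) p ` {q \<in> Q. le_by Q q (g - p)})"
      by blast
  qed
  moreover have "finite (\<Union>p\<in>P. (+) p ` {q \<in> Q. le_by Q q (g - p)})"
    using assms downward_finite_Q by (simp add: downward_finite_def)
  ultimately show "finite {u \<in> {u. \<exists>p\<in>P. le_by Q p u}. le_by Q u g}"
    by (rule finite_subset)
qed

lemma free_grading_support:
  assumes "free_grading R RG deg I g \<noteq> {\<zero>\<^bsub>free_module R I\<^esub>}"
  obtains i where "i \<in> I" and "le_by Q (deg i) g"
proof -
  have "(\<lambda>_. \<zero>\<^bsub>R\<^esub>) \<in> free_grading R RG deg I g"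
    by (auto simp: free_grading_def R.mem_free_module)
  then obtain f where f: "f \<in> free_grading R RG deg I g" "f \<noteq> (\<lambda>_. \<zero>\<^bsub>R\<^esub>)"
    using assms by auto
  then obtain i where i: "f i \<noteq> \<zero>\<^bsub>R\<^esub>"
    by blast
  have "f i \<in> RG (g - deg i)" "i \<in> I"
    using f i by (auto simp: free_grading_def R.mem_free_module)
  then show thesis
    using that[of i] i by (auto simp: le_by_def mem_support_iff)
qed

end

section \<open>Height of degrees in a bounded up-closed set\<close>

text \<open>Up-closedness ensures that a free module with generators in \<open>U\<close> has its
  whole support in \<open>U\<close>. This keeps all stages inside one set.\<close>

locale pdcf_bounded = pdcf_domain k R RG
  for k :: "('k, 'z) ring_scheme" and R :: "('k, 'r) module"
    and RG :: "'g :: ab_group_add \<Rightarrow> 'r set" +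
  fixes U :: "'g set"
  assumes up_closed: "u \<in> U \<Longrightarrow> le_by Q u v \<Longrightarrow> v \<in> U"
    and bounded_U: "finitely_bounded_below Q U"
    and downward_finite_U: "downward_finite Q U"
begin

text \<open>A chain in \<open>U\<close> ending at \<open>g\<close> has at most
  \<open>height g\<close> members.\<close>

definition height :: "'g \<Rightarrow> nat" where
  "height g = card {u \<in> U. le_by Q u g}"

lemma finite_below: "finite {u \<in> U. le_by Q u g}"
  using downward_finite_U by (simp add: downward_finite_def)

lemma height_mono: "le_by Q g h \<Longrightarrow> height g \<le> height h"
  unfolding height_def by (rule card_mono[OF finite_below]) (auto intro: le_trans)

text \<open>Everything counted for \<open>g\<close> is counted for \<open>h\<close>; in addition
  \<open>h\<close> counts itself, and by antisymmetry it is not below \<open>g\<close>.\<close>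

lemma height_strict_mono:
  assumes "le_by Q g h" and "g \<noteq> h" and "h \<in> U"
  shows "height g < height h"
  unfolding height_def
proof (rule psubset_card_mono[OF finite_below])
  have "h \<notin> {u \<in> U. le_by Q u g}" "h \<in> {u \<in> U. le_by Q u h}"
    using assms le_antisym le_refl by blast+
  moreover have "{u \<in> U. le_by Q u g} \<subseteq> {u \<in> U. le_by Q u h}"
    using assms le_trans by blast
  ultimately show "{u \<in> U. le_by Q u g} \<subset> {u \<in> U. le_by Q u h}"
    by blast
qed

text \<open>\<open>g\<close> counts itself. This starts the recursion: the degrees of
  \<open>M\<close> satisfy the bound for stage 0.\<close>

lemma height_pos: "g \<in> U \<Longrightarrow> 0 < height g"
  unfolding height_def using finite_below[of g] le_refl by (auto simp: card_gt_0_iff)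

text \<open>The condition on generators at stage \<open>n\<close>. The inequality is strict, so that
  stage \<open>n\<close> is empty in all degrees of height at most \<open>n\<close>.\<close>

definition admissible :: "nat \<Rightarrow> ('g \<times> nat) set \<Rightarrow> bool" where
  "admissible n B \<longleftrightarrow> (\<forall>b\<in>B. fst b \<in> U \<and> n < height (fst b)) \<and> (\<forall>g. finite {b \<in> B. fst b = g})"

lemma finite_index_below:
  assumes "admissible n B"
  shows "finite {b \<in> B. le_by Q (fst b) g}"
proof (rule finite_subset)
  show "{b \<in> B. le_by Q (fst b) g} \<subseteq> (\<Union>u\<in>{u \<in> U. le_by Q u g}. {b \<in> B. fst b = u})"
    using assms by (auto simp: admissible_def)
  show "finite (\<Union>u\<in>{u \<in> U. le_by Q u g}. {b \<in> B. fst b = u})"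
    using assms finite_below by (simp add: admissible_def)
qed

text \<open>A degree of the module lies above the degree of some generator; going up stays in
  \<open>U\<close> and does not lower the height.\<close>

lemma support_free_module:
  assumes "admissible n B"
  shows "graded_support (free_module R B) (free_grading R RG fst B) \<subseteq> {g \<in> U. n < height g}"
proof
  fix g assume "g \<in> graded_support (free_module R B) (free_grading R RG fst B)"
  then have "free_grading R RG fst B g \<noteq> {\<zero>\<^bsub>free_module R B\<^esub>}"
    by (simp only: graded_support_def mem_Collect_eq not_False_eq_True)
  then obtain b where "b \<in> B" and le: "le_by Q (fst b) g"
    by (rule free_grading_support)
  then have "fst b \<in> U" "n < height (fst b)"
    using assms by (auto simp: admissible_def)
  then show "g \<in> {g \<in> U. n < height g}"
    using up_closed[OF _ le] height_mono[OF le] by auto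
qed

lemma bdf_module_free_module:
  assumes "admissible n B"
  shows "bdf_module k R RG (free_module R B) (free_grading R RG fst B)"
  unfolding bdf_module_def
  using graded_module_free_module[of B fst]
    finitely_bounded_below_mono[OF bounded_U, of "graded_support (free_module R B) (free_grading R RG fst B)"]
    downward_finite_mono[OF downward_finite_U, of "graded_support (free_module R B) (free_grading R RG fst B)"]
    locally_fin_dim_free_module[OF finite_index_below[OF assms]]
    support_free_module[OF assms]
  by blast

section \<open>Syzygies and the recursive construction\<close>

text \<open>The kernel is carried along as \<open>K\<close> because the next stage takes it as its
  \<open>L\<close>; the image of one map is then by construction the kernel of the preceding
  one.\<close>

definition covers ::
    "('r, 'm) module \<Rightarrow> ('g \<Rightarrow> 'm set) \<Rightarrow> 'm set \<Rightarrow> ('g \<times> nat) set \<Rightarrow> ('g \<times> nat \<Rightarrow> 'r) set \<Rightarrow>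
     (('g \<times> nat \<Rightarrow> 'r) \<Rightarrow> 'm) \<Rightarrow> bool" where
  "covers N NG L B K \<phi> \<longleftrightarrow>
    graded_map R (free_module R B) (free_grading R RG fst B) N NG \<phi> \<and>
    \<phi> ` carrier (free_module R B) = L \<and> K = a_kernel (free_module R B) N \<phi>"

text \<open>The kernel is one unit of height above the generators. This is exactly the bound needed
  to cover it by generators admissible for \<open>Suc n\<close>.\<close>

definition syzygy_step :: "nat \<Rightarrow> ('g \<times> nat) set \<Rightarrow> ('g \<times> nat \<Rightarrow> 'r) set \<Rightarrow> bool" where
  "syzygy_step n B K \<longleftrightarrow> admissible n B \<and>
    graded_submodule R (free_module R B) (free_grading R RG fst B) K \<and>
    (\<forall>g. K \<inter> free_grading R RG fst B g \<noteq> {\<zero>\<^bsub>free_module R B\<^esub>} \<longrightarrow> g \<in> U \<and> Suc n < height g)"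

text \<open>A degree of the kernel lies strictly above a degree of \<open>L\<close>, which has
  height above \<open>n\<close>, and \<open>height_strict_mono\<close> supplies the extra
  unit.\<close>

lemma exists_cover:
  assumes N: "graded_module k R RG N NG"
    and fd: "locally_fin_dim k (restrict_scalars R N) NG" and L: "graded_submodule R N NG L"
    and supp: "\<And>g. L \<inter> NG g \<noteq> {\<zero>\<^bsub>N\<^esub>} \<Longrightarrow> g \<in> U \<and> n < height g"
  shows "\<exists>B K \<phi>. syzygy_step n B K \<and> covers N NG L B K \<phi>"
proof -
  interpret N: pdcf_graded_module k R RG N NG
    by unfold_locales (rule N)
  show ?thesis
  proof (rule N.graded_free_cover[OF fd L])
    fix B :: "('g \<times> nat) set" and \<phi>
    let ?F = "free_module R B" and ?FG = "free_grading R RG fst B"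
    let ?K = "a_kernel ?F N \<phi>"
    assume B: "\<And>b. b \<in> B \<Longrightarrow> L \<inter> NG (fst b) \<noteq> {\<zero>\<^bsub>N\<^esub>}" "\<And>g. finite {b \<in> B. fst b = g}"
      and \<phi>: "graded_map R ?F ?FG N NG \<phi>" "\<phi> ` carrier ?F = L"
      and ker: "\<And>g. ?K \<inter> ?FG g \<noteq> {\<zero>\<^bsub>?F\<^esub>} \<Longrightarrow> \<exists>h. L \<inter> NG h \<noteq> {\<zero>\<^bsub>N\<^esub>} \<and> le_by Q h g \<and> h \<noteq> g"
    interpret F: pdcf_graded_module k R RG ?F ?FG
      by unfold_locales (rule graded_module_free_module)
    have hom: "mod_hom R ?F N \<phi>" and graded: "\<phi> ` ?FG g \<subseteq> NG g" for g
      using \<phi>(1)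
      by (simp_all add: mod_hom_def mod_hom_axioms_def graded_map_def F.N.module_axioms
          N.N.module_axioms)
    have "graded_submodule R ?F ?FG ?K"
      by (rule F.graded_submodule_kernel[OF N.pdcf_graded_module_axioms hom graded])
    moreover have "admissible n B"
      unfolding admissible_def using supp[OF B(1)] B(2) by blast
    moreover have "g \<in> U \<and> Suc n < height g" if K: "?K \<inter> ?FG g \<noteq> {\<zero>\<^bsub>?F\<^esub>}" for g
    proof -
      obtain h where h: "L \<inter> NG h \<noteq> {\<zero>\<^bsub>N\<^esub>}" "le_by Q h g" "h \<noteq> g"
        using ker[OF K] by blast
      have "h \<in> U" and "n < height h"
        using supp[OF h(1)] by blast+
      moreover from this have "g \<in> U"
        using up_closed h(2) by blast
      ultimately show ?thesis
        using height_strict_mono[OF h(2,3)] by simp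
    qed
    ultimately have "syzygy_step n B ?K"
      unfolding syzygy_step_def by blast
    moreover have "covers N NG L B ?K \<phi>"
      using \<phi> by (simp add: covers_def)
    ultimately show "\<exists>B K \<phi>. syzygy_step n B K \<and> covers N NG L B K \<phi>"
      by blast
  qed
qed

lemma exists_resolution:
  assumes M: "bdf_module k R RG M MG" and supp: "graded_support M MG \<subseteq> U"
  shows "\<exists>(F :: nat \<Rightarrow> ('r, 'g \<times> nat \<Rightarrow> 'r) module) FG d \<epsilon>.
    gamma_finite_free_resolution k R RG M MG F FG d \<epsilon>"
proof -
  interpret M: pdcf_graded_module k R RG M MG
    by unfold_locales (use M in \<open>simp add: bdf_module_def\<close>)
  let ?F = "\<lambda>B. free_module R B" and ?FG = "\<lambda>B. free_grading R RG fst B"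
  \<comment> \<open>The cover of \<open>M\<close> stays outside the recursion, since elements of
    \<open>M\<close> have their own type; all later stages are covers of kernels in free
    modules.\<close>
  have "\<exists>B K \<phi>. syzygy_step 0 B K \<and> covers M MG (carrier M) B K \<phi>"
  proof (rule exists_cover[OF M.graded_module_N _ M.graded_submodule_carrier])
    show "locally_fin_dim k (restrict_scalars R M) MG"
      using M by (simp add: bdf_module_def)
    fix g assume "carrier M \<inter> MG g \<noteq> {\<zero>\<^bsub>M\<^esub>}"
    moreover have "carrier M \<inter> MG g = MG g"
      using M.NG_closed by blast
    ultimately have "g \<in> U"
      using supp by (auto simp: graded_support_def)
    then show "g \<in> U \<and> 0 < height g"
      using height_pos by blast
  qed
  then obtain B0 K0 \<epsilon> where s0: "syzygy_step 0 B0 K0" and \<epsilon>: "covers M MG (carrier M) B0 K0 \<epsilon>"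
    by blast
  \<comment> \<open>The start is pinned to \<open>(B0, K0)\<close>: the chosen sequence must begin
    with the very module on which \<open>\<epsilon>\<close> is defined, and with its kernel.\<close>
  define P where "P n s \<longleftrightarrow> syzygy_step n (fst s) (snd s) \<and> (n = 0 \<longrightarrow> s = (B0, K0))" for n s
  \<comment> \<open>A state holds only generators and kernel. The differential joining two states is
    quantified away here and chosen afterwards as \<open>d\<close>.\<close>
  define S where "S s s' \<longleftrightarrow> (\<exists>\<phi>. covers (?F (fst s)) (?FG (fst s)) (snd s) (fst s') (snd s') \<phi>)"
    for s s' :: "('g \<times> nat) set \<times> ('g \<times> nat \<Rightarrow> 'r) set"
  have "\<exists>s'. P (Suc n) s' \<and> S s s'" if "P n s" for n s
  proof -
    have s: "syzygy_step n (fst s) (snd s)"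
      using that by (simp add: P_def)
    have "\<exists>B K \<phi>. syzygy_step (Suc n) B K \<and> covers (?F (fst s)) (?FG (fst s)) (snd s) B K \<phi>"
    proof (rule exists_cover[OF graded_module_free_module])
      show "locally_fin_dim k (restrict_scalars R (?F (fst s))) (?FG (fst s))"
        using s by (intro locally_fin_dim_free_module finite_index_below[of n])
          (simp add: syzygy_step_def)
    qed (use s in \<open>simp_all add: syzygy_step_def\<close>)
    then obtain B K \<phi> where "syzygy_step (Suc n) B K" "covers (?F (fst s)) (?FG (fst s)) (snd s) B K \<phi>"
      by blast
    then show ?thesis
      by (intro exI[of _ "(B, K)"]) (auto simp: P_def S_def)
  qed
  moreover have "\<exists>s. P 0 s"
    using s0 by (auto simp: P_def)
  ultimately obtain s where s: "\<And>n. P n (s n)" "\<And>n. S (s n) (s (Suc n))"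
    using dependent_nat_choice[of P "\<lambda>_. S"] by blast
  define B where "B n = fst (s n)" for n
  define K where "K n = snd (s n)" for n
  have step: "syzygy_step n (B n) (K n)" for n
    using s(1)[of n] by (simp add: P_def B_def K_def)
  have B0: "B 0 = B0" "K 0 = K0"
    using s(1)[of 0] by (simp_all add: P_def B_def K_def)
  have "\<exists>\<phi>. covers (?F (B n)) (?FG (B n)) (K n) (B (Suc n)) (K (Suc n)) \<phi>" for n
    using s(2)[of n] by (simp add: S_def B_def K_def)
  then obtain d where d: "\<And>n. covers (?F (B n)) (?FG (B n)) (K n) (B (Suc n)) (K (Suc n)) (d n)"
    by metis
  have adm: "admissible n (B n)" for n
    using step[of n] by (simp add: syzygy_step_def)
  have sup: "graded_support (?F (B n)) (?FG (B n)) \<subseteq> {g \<in> U. n < height g}" for n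
    by (rule support_free_module[OF adm])
  then have U: "(\<Union>n. graded_support (?F (B n)) (?FG (B n))) \<subseteq> U"
    by blast
  have "gamma_finite k R RG (\<lambda>n. ?F (B n)) (\<lambda>n. ?FG (B n)) d"
    unfolding gamma_finite_def
  proof (intro conjI allI)
    show "\<exists>N. \<forall>n\<ge>N. ?FG (B n) g = {\<zero>\<^bsub>?F (B n)\<^esub>}" for g
    \<comment> \<open>At stage \<open>n\<close> every degree of the support has height above
      \<open>n\<close>, so degree \<open>g\<close> is empty from stage \<open>height g\<close>
      on.\<close>
    proof (intro exI[of _ "height g"] allI impI)
      fix n assume "height g \<le> n"
      then have "g \<notin> graded_support (?F (B n)) (?FG (B n))"
        using sup[of n] by auto
      then show "?FG (B n) g = {\<zero>\<^bsub>?F (B n)\<^esub>}"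
        by (simp add: graded_support_def)
    qed
  qed (use d bdf_module_free_module[OF adm] finitely_bounded_below_mono[OF bounded_U U]
      downward_finite_mono[OF downward_finite_U U] in \<open>simp_all add: covers_def\<close>)
  then have "gamma_finite_free_resolution k R RG M MG (\<lambda>n. ?F (B n)) (\<lambda>n. ?FG (B n)) d \<epsilon>"
    unfolding gamma_finite_free_resolution_def
    using \<epsilon> d by (simp add: covers_def B0 graded_free_free_module)
  then show ?thesis by blast
qed

end

theorem theorem4:
  fixes k :: "'k ring"
    and R :: "('k, 'r) module"
    and RG :: "'g :: ab_group_add \<Rightarrow> 'r set"
    and r :: "nat \<Rightarrow> 'r"
    and M :: "('r, 'm) module"
    and MG :: "'g \<Rightarrow> 'm set"
  assumes "field k"
    and "graded_algebra k R RG"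
    and "domain R"
    and "pdcf k R RG"
    and "\<And>i. \<exists>g. r i \<in> RG g"
    and "regular_sequence R r"
    and "genideal R (range r) = positive_part k R RG"
    and "bdf_module k R RG M MG"
  shows "\<exists>(F :: nat \<Rightarrow> ('r, 'g \<times> nat \<Rightarrow> 'r) module) FG d \<epsilon>.
    gamma_finite_free_resolution k R RG M MG F FG d \<epsilon>"
proof -
  interpret pdcf_domain k R RG
    by (rule pdcf_domain.intro) (fact assms)+
  obtain P where P: "finite P" "\<And>u. u \<in> graded_support M MG \<Longrightarrow> \<exists>p\<in>P. le_by Q p u"
    using assms(8) by (auto simp: bdf_module_def finitely_bounded_below_def)
  \<comment> \<open>The smallest up-closed set containing the bounds \<open>P\<close>: it contains
    the support of \<open>M\<close> and is itself bounded below by \<open>P\<close>.\<close>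
  interpret pdcf_bounded k R RG "{u. \<exists>p\<in>P. le_by Q p u}"
  proof unfold_locales
    show "finitely_bounded_below Q {u. \<exists>p\<in>P. le_by Q p u}"
      using P(1) by (auto simp: finitely_bounded_below_def)
    show "downward_finite Q {u. \<exists>p\<in>P. le_by Q p u}"
      by (rule downward_finite_up_closure[OF P(1)])
  qed (use le_trans in blast)
  show ?thesis
    by (rule exists_resolution[OF assms(8)]) (use P(2) in blast)
qed

end
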